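(* Let $L_j$ be a jump Lévy basis on $\mathbb{R}^2$ with Lévy measure $l$, given by $$L_j(B)=\int_B\int_{(-1,1)}y\,\mathrm{d}(N-\nu)(\mathbf{z},y)+\int_B\int_{\mathbb{R}\setminus(-1,1)}y\,\mathrm{d}N(\mathbf{z},y),$$ and for $\epsilon\in(0,1)$ let $$L_j^\epsilon(B)=\int_B\int_{(-1,-\epsilon)\cup(\epsilon,1)}y\,\mathrm{d}(N-\nu)(\mathbf{z},y)+\int_B\int_{\mathbb{R}\setminus(-1,1)}y\,\mathrm{d}N(\mathbf{z},y).$$ Let $A=\{(s,x):s<0,\ 0<x<\phi(s)\}$ with $\phi:(-\infty,0]\to[0,\infty)$ continuous, increasing and $\int_{-\infty}^0\phi<\infty$ (bounded or unbounded), $A_t=A+(t,0)$, $X_t=L_j(A_t)$ and $X^\epsilon_t=L^\epsilon_j(A_t)$. Then (for càdlàg versions of these processes) for every sequence $\epsilon_n\downarrow0$, almost surely $\sup_{t\in[0,T]}|X^{\epsilon_n}_t-X_t|\to0$ for every $T>0$; i.e. $X^\epsilon$ converges to $X$ uniformly on compacts in the space of càdlàg paths as $\epsilon\to0$. The same holds if a Gaussian Lévy basis part $L_g(A_t)$ (independent of $N$) is added to both $X$ and $X^\epsilon$.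
   Context: $N$ is a Poisson random measure on $\mathbb{R}^2\times\mathbb{R}$ with intensity $\nu=\mathrm{Leb}\otimes l$, where $\mathrm{Leb}$ is Lebesgue measure on $\mathbb{R}^2$ and $l$ is a Lévy measure on $\mathbb{R}$ ($l(\{0\})=0$, $\int\min(1,y^2)\,l(\mathrm{d}y)<\infty$); $\mathbf{z}=(t,x)$ denotes the space-time location of a jump and $y$ its size. A Gaussian Lévy basis $L_g$ with parameters $(\xi,a)$ is an independently scattered, additive family with $L_g(B)\sim\mathcal{N}(\xi\,\mathrm{Leb}(B),a\,\mathrm{Leb}(B))$. *)

theory Defs
  imports "HOL-Probability.Probability"
begin

definition levy_measure :: "real measure \<Rightarrow> bool" where
  "levy_measure l \<longleftrightarrow> sets l = sets borel \<and> emeasure l {0} = 0 \<and>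
     (\<integral>\<^sup>+ y. ennreal (min 1 (y\<^sup>2)) \<partial>l) < \<infinity>"

text \<open>Intensity nu = Leb (on R^2) times l; points are ((t,x),y).\<close>
definition intensity :: "real measure \<Rightarrow> ((real \<times> real) \<times> real) measure" where
  "intensity l = (lborel :: (real \<times> real) measure) \<Otimes>\<^sub>M l"

definition poisson_random_measure ::
  "'w measure \<Rightarrow> ('w \<Rightarrow> ((real \<times> real) \<times> real) measure) \<Rightarrow> real measure \<Rightarrow> bool" where
  "poisson_random_measure M N l \<longleftrightarrow>
     (\<forall>\<omega>\<in>space M. sets (N \<omega>) = sets (intensity l)) \<and>
     (\<forall>C\<in>sets (intensity l). (\<lambda>\<omega>. emeasure (N \<omega>) C) \<in> borel_measurable M) \<and>
     (\<forall>C\<in>sets (intensity l). emeasure (intensity l) C < \<infinity> \<longrightarrow>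
        (\<forall>k::nat. measure M {\<omega>\<in>space M. emeasure (N \<omega>) C = of_nat k} =
           exp (- measure (intensity l) C) * measure (intensity l) C ^ k / fact k)) \<and>
     (\<forall>(C :: nat \<Rightarrow> ((real \<times> real) \<times> real) set) I. finite I \<longrightarrow> disjoint_family_on C I \<longrightarrow>
        (\<forall>i\<in>I. C i \<in> sets (intensity l)) \<longrightarrow>
        prob_space.indep_vars M (\<lambda>_. borel) (\<lambda>i \<omega>. emeasure (N \<omega>) (C i)) I)"

definition small_jumps :: "real \<Rightarrow> real set" where
  "small_jumps \<epsilon> = {y. \<epsilon> < \<bar>y\<bar> \<and> \<bar>y\<bar> < 1}"

definition big_jumps :: "real set" where
  "big_jumps = {y. 1 \<le> \<bar>y\<bar>}"

definition Lj_eps ::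
  "('w \<Rightarrow> ((real \<times> real) \<times> real) measure) \<Rightarrow> real measure \<Rightarrow> real \<Rightarrow> (real \<times> real) set \<Rightarrow> 'w \<Rightarrow> real" where
  "Lj_eps N l \<epsilon> B \<omega> =
     (\<integral>p. indicator (B \<times> small_jumps \<epsilon>) p * snd p \<partial>(N \<omega>))
     - (\<integral>p. indicator (B \<times> small_jumps \<epsilon>) p * snd p \<partial>(intensity l))
     + (\<integral>p. indicator (B \<times> big_jumps) p * snd p \<partial>(N \<omega>))"

text \<open>Z is (a version of) L_j(B): the compensated small-jump integral is the limit in
  probability of its truncations as eps -> 0+ (outer-probability formulation).\<close>
definition is_Lj ::
  "'w measure \<Rightarrow> ('w \<Rightarrow> ((real \<times> real) \<times> real) measure) \<Rightarrow> real measure \<Rightarrow> (real \<times> real) set \<Rightarrow> ('w \<Rightarrow> real) \<Rightarrow> bool" where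
  "is_Lj M N l B Z \<longleftrightarrow> Z \<in> borel_measurable M \<and>
     (\<forall>\<delta>>0. \<forall>\<eta>>0. \<forall>\<^sub>F \<epsilon> in at_right 0.
        \<exists>E\<in>sets M. measure M E < \<eta> \<and>
          (AE \<omega> in M. \<omega> \<notin> E \<longrightarrow> \<bar>Lj_eps N l \<epsilon> B \<omega> - Z \<omega>\<bar> \<le> \<delta>))"

definition gaussian_levy_basis ::
  "'w measure \<Rightarrow> real \<Rightarrow> real \<Rightarrow> ((real \<times> real) set \<Rightarrow> 'w \<Rightarrow> real) \<Rightarrow> bool" where
  "gaussian_levy_basis M \<xi> a G \<longleftrightarrow> 0 \<le> a \<and>
     (\<forall>B\<in>sets (lborel :: (real \<times> real) measure). emeasure lborel B < \<infinity> \<longrightarrow>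
        G B \<in> borel_measurable M \<and>
        (if 0 < a * measure lborel B
         then distributed M lborel (G B)
                (\<lambda>x. ennreal (normal_density (\<xi> * measure lborel B) (sqrt (a * measure lborel B)) x))
         else (AE \<omega> in M. G B \<omega> = \<xi> * measure lborel B))) \<and>
     (\<forall>(C :: nat \<Rightarrow> (real \<times> real) set) I. finite I \<longrightarrow> disjoint_family_on C I \<longrightarrow>
        (\<forall>i\<in>I. C i \<in> sets lborel \<and> emeasure lborel (C i) < \<infinity>) \<longrightarrow>
        prob_space.indep_vars M (\<lambda>_. borel) (\<lambda>i. G (C i)) I) \<and>
     (\<forall>B C. B \<in> sets lborel \<longrightarrow> C \<in> sets lborel \<longrightarrow> emeasure lborel B < \<infinity> \<longrightarrow>
        emeasure lborel C < \<infinity> \<longrightarrow> B \<inter> C = {} \<longrightarrow>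
        (AE \<omega> in M. G (B \<union> C) \<omega> = G B \<omega> + G C \<omega>))"

definition indep_gauss_prm ::
  "'w measure \<Rightarrow> ('w \<Rightarrow> ((real \<times> real) \<times> real) measure) \<Rightarrow> real measure \<Rightarrow> ((real \<times> real) set \<Rightarrow> 'w \<Rightarrow> real) \<Rightarrow> bool" where
  "indep_gauss_prm M N l G \<longleftrightarrow> prob_space.indep_set M
     (sigma_sets (space M) {(\<lambda>\<omega>. emeasure (N \<omega>) C) -` U \<inter> space M | C U.
        C \<in> sets (intensity l) \<and> U \<in> sets (borel :: ennreal measure)})
     (sigma_sets (space M) {G B -` U \<inter> space M | B U.
        B \<in> sets (lborel :: (real \<times> real) measure) \<and> emeasure lborel B < \<infinity> \<and> U \<in> sets (borel :: real measure)})"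

definition ambit_set :: "(real \<Rightarrow> real) \<Rightarrow> (real \<times> real) set" where
  "ambit_set \<phi> = {(s, x). s < 0 \<and> 0 < x \<and> x < \<phi> s}"

definition shift_set :: "(real \<times> real) set \<Rightarrow> real \<Rightarrow> (real \<times> real) set" where
  "shift_set A t = (\<lambda>(s, x). (s + t, x)) ` A"

definition cadlag :: "(real \<Rightarrow> real) \<Rightarrow> bool" where
  "cadlag f \<longleftrightarrow> (\<forall>t\<ge>0. (f \<longlongrightarrow> f t) (at_right t)) \<and>
                 (\<forall>t>0. \<exists>L. (f \<longlongrightarrow> L) (at_left t))"

end

theory Submission
  imports Defs
begin

text \<open>
  The set \<open>A\<^sub>t\<close> is a difference \<open>U\<^sub>t - D\<^sub>t\<close> of two increasing families of sets of finite area: the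
  points that have entered by time \<open>t\<close>, and those among them that have already departed. Over an
  increasing family and over shells \<open>{u < |y| \<le> v}\<close> of jump sizes, the compensated Poisson integrals
  are partial sums, in time and in jump size, of independent centred variables. Applying Ottaviani's
  inequality once in each direction bounds the probability that some partial sum is large by the
  second moment \<open>Leb(U\<^sub>T) \<integral>\<^bsub>|y| \<le> v\<^esub> y\<^sup>2 dl\<close>, which tends to \<open>0\<close> with \<open>v\<close>. Hence \<open>X\<^sup>\<epsilon>\<close> is almost surely
  uniformly Cauchy over the dyadic times; its limit there is \<open>X\<close>, and right-continuity extends the
  estimate to all times. Differences of \<open>X\<^sup>\<epsilon>\<close> contain neither the large jumps nor the Gaussian part.
\<close>

section \<open>Maximal inequalities for independent sums\<close>

text \<open>Points both enter and leave the ambit set as time passes, so in general \<open>X\<close>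
  has neither independent increments nor the martingale property. This is why two monotone families
  are needed: over each of them the integrals are genuine partial sums. A maximum over time alone
  would give uniform convergence in probability, hence almost sure convergence only along
  subsequences; including the truncation levels in the maximum yields it for the whole sequence.

  The law of \<open>N\<close> is given only through finitely many counts at a time, whereas an
  integral of \<open>y\<close> is not a finite combination of counts. Jump sizes are therefore
  rounded to multiples of \<open>1/k\<close>, and the limit
  \<open>k \<rightarrow> \<infinity>\<close> is taken inside the probability bound, followed by the
  limit over finite grids of times and levels.

  Each use of Ottaviani's inequality doubles both the threshold and the bound, so \<open>L\<close>
  and \<open>V/L\<^sup>2\<close> become \<open>4 L\<close> and \<open>4 V/L\<^sup>2\<close>;
  rounding costs another factor 4 in the variance, whence 16.\<close>

context prob_space begin

text \<open>Fatou's lemma for sets: \<open>E\<close> lies almost surely in the lower limit of the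
  \<open>A k\<close>, which is the increasing union of the tail intersections \<open>Q j\<close>. It
  serves both limits to come, that of finer rounding of jump sizes and that of finer dyadic
  grids.\<close>

lemma prob_le_of_eventually:
  assumes E: "E \<in> events" and A: "\<And>k. A k \<in> events"
    and le: "eventually (\<lambda>k. prob (A k) \<le> c) sequentially"
    and ev: "AE x in M. x \<in> E \<longrightarrow> eventually (\<lambda>k. x \<in> A k) sequentially"
  shows "prob E \<le> c"
proof -
  define Q where "Q j = (\<Inter>k\<in>{j..}. A k)" for j
  have Q: "Q j \<in> events" for j unfolding Q_def using A by (intro sets.countable_INT') auto
  have "incseq Q" unfolding Q_def by (intro monoI INF_superset_mono) auto
  then have lim: "(\<lambda>j. prob (Q j)) \<longlonglongrightarrow> prob (\<Union>j. Q j)"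
    using Q by (intro finite_Lim_measure_incseq) auto
  have "eventually (\<lambda>j. prob (Q j) \<le> c) sequentially"
    using le
  proof eventually_elim
    case (elim k)
    have "prob (Q k) \<le> prob (A k)" using A by (intro finite_measure_mono) (auto simp: Q_def)
    then show ?case using elim by simp
  qed
  then have "prob (\<Union>j. Q j) \<le> c" using tendsto_upperbound[OF lim] by simp
  moreover have "prob E \<le> prob (\<Union>j. Q j)"
  proof (rule finite_measure_mono_AE)
    show "AE x in M. x \<in> E \<longrightarrow> x \<in> (\<Union>j. Q j)"
      using ev by eventually_elim (auto simp: Q_def eventually_sequentially)
  qed (use Q in auto)
  ultimately show ?thesis by simp
qed

lemma indep_sum_second_moment:
  fixes W :: "'i \<Rightarrow> 'a \<Rightarrow> real"
  assumes K: "finite K" and ind: "indep_vars (\<lambda>_. borel) W K"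
    and sq: "\<And>c. c \<in> K \<Longrightarrow> integrable M (\<lambda>\<omega>. (W c \<omega>)\<^sup>2)"
    and cent: "\<And>c. c \<in> K \<Longrightarrow> expectation (W c) = 0"
  shows "integrable M (\<lambda>\<omega>. (\<Sum>c\<in>K. W c \<omega>)\<^sup>2)"
    and "expectation (\<lambda>\<omega>. (\<Sum>c\<in>K. W c \<omega>)\<^sup>2) = (\<Sum>c\<in>K. expectation (\<lambda>\<omega>. (W c \<omega>)\<^sup>2))"
proof -
  have rv [measurable]: "W c \<in> borel_measurable M" if "c \<in> K" for c
    using ind that by (auto simp: indep_vars_def)
  have int: "integrable M (W c)" if "c \<in> K" for c
    by (rule square_integrable_imp_integrable[OF rv[OF that] sq[OF that]])
  have prod: "integrable M (\<lambda>\<omega>. W c \<omega> * W d \<omega>) \<and> expectation (\<lambda>\<omega>. W c \<omega> * W d \<omega>) = 0"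
    if "c \<in> K" "d \<in> K" "c \<noteq> d" for c d
  proof -
    have i: "indep_vars (\<lambda>_. borel) W {c, d}" by (rule indep_vars_subset[OF ind]) (use that in auto)
    have "\<And>i. i \<in> {c, d} \<Longrightarrow> integrable M (W i)" using that int by auto
    from indep_vars_integrable[OF _ i this] indep_vars_lebesgue_integral[OF _ i this]
    show ?thesis using that cent by simp
  qed
  have int2: "integrable M (\<lambda>\<omega>. W c \<omega> * W d \<omega>)" if "c \<in> K" "d \<in> K" for c d
    using prod[OF that] sq[of c] that by (cases "c = d") (auto simp: power2_eq_square)
  have expand: "(\<Sum>c\<in>K. W c \<omega>)\<^sup>2 = (\<Sum>c\<in>K. \<Sum>d\<in>K. W c \<omega> * W d \<omega>)" for \<omega>
    by (simp add: power2_eq_square sum_product)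
  show "integrable M (\<lambda>\<omega>. (\<Sum>c\<in>K. W c \<omega>)\<^sup>2)"
    unfolding expand using int2 by (intro Bochner_Integration.integrable_sum) auto
  have "expectation (\<lambda>\<omega>. (\<Sum>c\<in>K. W c \<omega>)\<^sup>2)
      = (\<Sum>c\<in>K. \<Sum>d\<in>K. expectation (\<lambda>\<omega>. W c \<omega> * W d \<omega>))"
    unfolding expand using int2 by (subst Bochner_Integration.integral_sum; (intro sum.cong refl Bochner_Integration.integral_sum Bochner_Integration.integrable_sum)?) auto
  also have "\<dots> = (\<Sum>c\<in>K. \<Sum>d\<in>K. if d = c then expectation (\<lambda>\<omega>. (W c \<omega>)\<^sup>2) else 0)"
    using prod by (intro sum.cong refl) (auto simp: power2_eq_square)
  also have "\<dots> = (\<Sum>c\<in>K. expectation (\<lambda>\<omega>. (W c \<omega>)\<^sup>2))" using K by simp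
  finally show "expectation (\<lambda>\<omega>. (\<Sum>c\<in>K. W c \<omega>)\<^sup>2) = (\<Sum>c\<in>K. expectation (\<lambda>\<omega>. (W c \<omega>)\<^sup>2))" .
qed

lemma indep_sum_Chebyshev:
  fixes W :: "'i \<Rightarrow> 'a \<Rightarrow> real"
  assumes K: "finite K" and ind: "indep_vars (\<lambda>_. borel) W K"
    and sq: "\<And>c. c \<in> K \<Longrightarrow> integrable M (\<lambda>\<omega>. (W c \<omega>)\<^sup>2)"
    and cent: "\<And>c. c \<in> K \<Longrightarrow> expectation (W c) = 0"
    and L: "0 < L"
  shows "prob {\<omega> \<in> space M. L < \<bar>\<Sum>c\<in>K. W c \<omega>\<bar>} \<le> (\<Sum>c\<in>K. expectation (\<lambda>\<omega>. (W c \<omega>)\<^sup>2)) / L\<^sup>2"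
proof -
  have rv [measurable]: "W c \<in> borel_measurable M" if "c \<in> K" for c
    using ind that by (auto simp: indep_vars_def)
  note S = indep_sum_second_moment[OF K ind sq cent]
  have "expectation (\<lambda>\<omega>. \<Sum>c\<in>K. W c \<omega>) = (\<Sum>c\<in>K. expectation (W c))"
    using square_integrable_imp_integrable[OF rv sq] by (intro Bochner_Integration.integral_sum) auto
  then have m: "expectation (\<lambda>\<omega>. \<Sum>c\<in>K. W c \<omega>) = 0" using cent by simp
  have "prob {\<omega> \<in> space M. L < \<bar>\<Sum>c\<in>K. W c \<omega>\<bar>} \<le> prob {\<omega> \<in> space M. L \<le> \<bar>\<Sum>c\<in>K. W c \<omega>\<bar>}"
    by (intro finite_measure_mono) auto
  also have "\<dots> \<le> (\<Sum>c\<in>K. expectation (\<lambda>\<omega>. (W c \<omega>)\<^sup>2)) / L\<^sup>2"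
    using Chebyshev_inequality[of "\<lambda>\<omega>. \<Sum>c\<in>K. W c \<omega>" L] S L by (simp add: m)
  finally show ?thesis .
qed

text \<open>First passage decomposition: on the event that the partial sums first exceed \<open>2L\<close> at
  rank \<open>b\<close>, the total exceeds \<open>L\<close> unless the remainder, which is independent of the past, does.\<close>
lemma Ottaviani_inequality:
  fixes W :: "'i \<Rightarrow> 'a \<Rightarrow> real" and r :: "'i \<Rightarrow> nat" and G :: "'t \<Rightarrow> 'i set"
  assumes K: "finite K" and Th: "finite \<Theta>" and ind: "indep_vars (\<lambda>_. borel) W K"
    and tail: "\<And>b. prob {\<omega> \<in> space M. \<exists>\<theta>\<in>\<Theta>. L < \<bar>\<Sum>c\<in>{c \<in> K \<inter> G \<theta>. b \<le> r c}. W c \<omega>\<bar>} \<le> q"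
    and q: "q \<le> 1/2"
  shows "prob {\<omega> \<in> space M. \<exists>b\<le>B. \<exists>\<theta>\<in>\<Theta>. 2 * L < \<bar>\<Sum>c\<in>{c \<in> K \<inter> G \<theta>. r c < b}. W c \<omega>\<bar>} \<le> 2 * q"
proof -
  have rv [measurable]: "W c \<in> borel_measurable M" if "c \<in> K" for c
    using ind that by (auto simp: indep_vars_def)
  define E where "E b = {\<omega> \<in> space M. \<exists>\<theta>\<in>\<Theta>. 2 * L < \<bar>\<Sum>c\<in>{c \<in> K \<inter> G \<theta>. r c < b}. W c \<omega>\<bar>}" for b
  define H where "H b = {\<omega> \<in> space M. \<exists>\<theta>\<in>\<Theta>. L < \<bar>\<Sum>c\<in>{c \<in> K \<inter> G \<theta>. b \<le> r c}. W c \<omega>\<bar>}" for b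
  define F where "F b = E b - (\<Union>b'<b. E b')" for b
  have Em [measurable]: "E b \<in> events" for b unfolding E_def using Th by measurable
  have Hm [measurable]: "H b \<in> events" for b unfolding H_def using Th by measurable
  have Fm [measurable]: "F b \<in> events" for b unfolding F_def by measurable
  have indep: "prob (F b \<inter> (space M - H b)) = prob (F b) * (1 - prob (H b))" for b
  proof -
    let ?A = "{c \<in> K. r c < b}" and ?B = "{c \<in> K. b \<le> r c}"
    let ?PA = "PiM ?A (\<lambda>_. borel :: real measure)" and ?PB = "PiM ?B (\<lambda>_. borel :: real measure)"
    \<comment> \<open>The coordinates of rank below \<open>b\<close> and those of rank at least
      \<open>b\<close> are independent as vectors. \<open>F'\<close> and \<open>H'\<close> express
      the two events on the respective product spaces, so that \<open>F b\<close> and the complement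
      of \<open>H b\<close> are preimages of them.\<close>
    have iv: "indep_var ?PA (\<lambda>\<omega>. restrict (\<lambda>i. W i \<omega>) ?A) ?PB (\<lambda>\<omega>. restrict (\<lambda>i. W i \<omega>) ?B)"
      by (rule indep_var_restrict[OF ind]) auto
    define E' where "E' b' = {x \<in> space ?PA. \<exists>\<theta>\<in>\<Theta>. 2 * L < \<bar>\<Sum>c\<in>{c \<in> K \<inter> G \<theta>. r c < b'}. x c\<bar>}" for b'
    define F' where "F' = E' b - (\<Union>b'<b. E' b')"
    define H' where "H' = {x \<in> space ?PB. \<not> (\<exists>\<theta>\<in>\<Theta>. L < \<bar>\<Sum>c\<in>{c \<in> K \<inter> G \<theta>. b \<le> r c}. x c\<bar>)}"
    have E'm: "E' b' \<in> sets ?PA" if "b' \<le> b" for b'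
    proof -
      have "(\<lambda>x. x c) \<in> borel_measurable ?PA" if "c \<in> {c \<in> K \<inter> G \<theta>. r c < b'}" for c \<theta>
        using that \<open>b' \<le> b\<close> by (intro measurable_component_singleton) auto
      then have "(\<lambda>x. \<Sum>c\<in>{c \<in> K \<inter> G \<theta>. r c < b'}. x c) \<in> borel_measurable ?PA" for \<theta>
        by (intro borel_measurable_sum) auto
      note [measurable] = this
      show ?thesis unfolding E'_def using Th by measurable
    qed
    have F'm: "F' \<in> sets ?PA" unfolding F'_def using E'm by (intro sets.Diff sets.finite_UN) auto
    have H'm: "H' \<in> sets ?PB"
    proof -
      have "(\<lambda>x. x c) \<in> borel_measurable ?PB" if "c \<in> {c \<in> K \<inter> G \<theta>. b \<le> r c}" for c \<theta>
        using that by (intro measurable_component_singleton) auto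
      then have "(\<lambda>x. \<Sum>c\<in>{c \<in> K \<inter> G \<theta>. b \<le> r c}. x c) \<in> borel_measurable ?PB" for \<theta>
        by (intro borel_measurable_sum) auto
      note [measurable] = this
      show ?thesis unfolding H'_def using Th by measurable
    qed
    have sumA: "(\<Sum>c\<in>{c \<in> K \<inter> G \<theta>. r c < b'}. restrict (\<lambda>i. W i \<omega>) ?A c) = (\<Sum>c\<in>{c \<in> K \<inter> G \<theta>. r c < b'}. W c \<omega>)"
      if "b' \<le> b" for b' \<theta> \<omega> using that by (intro sum.cong) auto
    have sumB: "(\<Sum>c\<in>{c \<in> K \<inter> G \<theta>. b \<le> r c}. restrict (\<lambda>i. W i \<omega>) ?B c) = (\<Sum>c\<in>{c \<in> K \<inter> G \<theta>. b \<le> r c}. W c \<omega>)"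
      for \<theta> \<omega> by (intro sum.cong) auto
    have preE: "(\<lambda>\<omega>. restrict (\<lambda>i. W i \<omega>) ?A) -` E' b' \<inter> space M = E b'" if "b' \<le> b" for b'
      using sumA[OF that] by (auto simp: E'_def E_def space_PiM)
    have preF: "(\<lambda>\<omega>. restrict (\<lambda>i. W i \<omega>) ?A) -` F' \<inter> space M = F b"
      unfolding F_def F'_def preE[OF order_refl, symmetric] using preE[OF less_imp_le] by auto
    have preH: "(\<lambda>\<omega>. restrict (\<lambda>i. W i \<omega>) ?B) -` H' \<inter> space M = space M - H b"
      using sumB by (auto simp: H'_def H_def space_PiM)
    have "F b \<inter> (space M - H b) = (\<lambda>\<omega>. (restrict (\<lambda>i. W i \<omega>) ?A, restrict (\<lambda>i. W i \<omega>) ?B)) -` (F' \<times> H') \<inter> space M"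
      using preF preH by auto
    then have "prob (F b \<inter> (space M - H b)) = prob (F b) * prob (space M - H b)"
      using indep_varD[OF iv F'm H'm] preF preH by simp
    then show ?thesis using prob_compl[OF Hm] by simp
  qed
  \<comment> \<open>Every rank is at least 0, so \<open>H 0\<close> speaks of the full sums. The
    index \<open>\<theta>\<close> that witnesses the passage at rank \<open>b\<close> also witnesses
    \<open>H 0\<close>.\<close>
  have sub: "F b \<inter> (space M - H b) \<subseteq> H 0" for b
  proof
    fix \<omega> assume \<omega>: "\<omega> \<in> F b \<inter> (space M - H b)"
    then obtain \<theta> where th: "\<theta> \<in> \<Theta>" "2 * L < \<bar>\<Sum>c\<in>{c \<in> K \<inter> G \<theta>. r c < b}. W c \<omega>\<bar>"
      by (auto simp: F_def E_def)
    have le: "\<bar>\<Sum>c\<in>{c \<in> K \<inter> G \<theta>. b \<le> r c}. W c \<omega>\<bar> \<le> L" using \<omega> th by (auto simp: H_def not_less)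
    have "{c \<in> K \<inter> G \<theta>. 0 \<le> r c} = {c \<in> K \<inter> G \<theta>. r c < b} \<union> {c \<in> K \<inter> G \<theta>. b \<le> r c}" by auto
    then have "(\<Sum>c\<in>{c \<in> K \<inter> G \<theta>. 0 \<le> r c}. W c \<omega>) =
        (\<Sum>c\<in>{c \<in> K \<inter> G \<theta>. r c < b}. W c \<omega>) + (\<Sum>c\<in>{c \<in> K \<inter> G \<theta>. b \<le> r c}. W c \<omega>)"
      using K by (simp only:) (intro sum.union_disjoint; auto)
    then have "L < \<bar>\<Sum>c\<in>{c \<in> K \<inter> G \<theta>. 0 \<le> r c}. W c \<omega>\<bar>" using th(2) le by linarith
    then show "\<omega> \<in> H 0" using \<omega> th unfolding H_def by blast
  qed
  have disj: "disjoint_family_on F {..B}"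
    unfolding disjoint_family_on_def
  proof (intro ballI impI)
    fix m n :: nat assume "m \<noteq> n"
    then show "F m \<inter> F n = {}" by (cases m n rule: linorder_cases) (auto simp: F_def)
  qed
  have U: "(\<Union>b\<le>B. E b) = (\<Union>b\<le>B. F b)"
  proof (intro equalityI subsetI)
    fix \<omega> assume "\<omega> \<in> (\<Union>b\<le>B. E b)"
    then obtain b where b: "b \<le> B" "\<omega> \<in> E b" by auto
    define m where "m = (LEAST b. \<omega> \<in> E b)"
    have "\<omega> \<in> E m" "m \<le> b" unfolding m_def using b by (auto intro: LeastI Least_le)
    moreover have "\<omega> \<notin> E b'" if "b' < m" for b' using that unfolding m_def by (rule not_less_Least)
    ultimately show "\<omega> \<in> (\<Union>b\<le>B. F b)" using b by (auto simp: F_def intro!: bexI[of _ m])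
  qed (auto simp: F_def)
  have "prob (\<Union>b\<le>B. E b) / 2 = (\<Sum>b\<le>B. prob (F b) / 2)"
    unfolding U using disj by (subst finite_measure_finite_Union) (auto simp: sum_divide_distrib)
  also have "\<dots> \<le> (\<Sum>b\<le>B. prob (F b \<inter> (space M - H b)))"
  proof (intro sum_mono)
    fix b
    \<comment> \<open>The complement of \<open>H b\<close> has probability at least 1/2; this is the
      source of the factor 2 in the conclusion.\<close>
    have "prob (H b) \<le> 1/2" using tail[of b] q by (simp add: H_def)
    then have "prob (F b) * (1/2) \<le> prob (F b) * (1 - prob (H b))" by (intro mult_left_mono) auto
    then show "prob (F b) / 2 \<le> prob (F b \<inter> (space M - H b))" by (simp add: indep)
  qed
  also have "\<dots> = prob (\<Union>b\<le>B. F b \<inter> (space M - H b))"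
    using disj by (intro finite_measure_finite_Union[symmetric]) (auto simp: disjoint_family_on_def)
  also have "\<dots> \<le> prob (H 0)" using sub by (intro finite_measure_mono) auto
  also have "\<dots> \<le> q" using tail[of 0] by (simp add: H_def)
  finally have "prob (\<Union>b\<le>B. E b) \<le> 2 * q" by simp
  moreover have "(\<Union>b\<le>B. E b) = {\<omega> \<in> space M. \<exists>b\<le>B. \<exists>\<theta>\<in>\<Theta>. 2 * L < \<bar>\<Sum>c\<in>{c \<in> K \<inter> G \<theta>. r c < b}. W c \<omega>\<bar>}"
    by (auto simp: E_def)
  ultimately show ?thesis by simp
qed

text \<open>Ottaviani's inequality in the direction \<open>s\<close>, restricted to indices with
  \<open>b \<le> r c\<close>, bounds a maximum over \<open>a\<close>. That bound is precisely the
  tail hypothesis for a second application in the direction \<open>r\<close>, with the values of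
  \<open>a\<close> as the auxiliary index set.\<close>

lemma two_parameter_maximal_inequality:
  fixes W :: "'i \<Rightarrow> 'a \<Rightarrow> real" and r s :: "'i \<Rightarrow> nat"
  assumes K: "finite K" and ind: "indep_vars (\<lambda>_. borel) W K"
    and sq: "\<And>c. c \<in> K \<Longrightarrow> integrable M (\<lambda>\<omega>. (W c \<omega>)\<^sup>2)"
    and cent: "\<And>c. c \<in> K \<Longrightarrow> expectation (W c) = 0"
    and V: "(\<Sum>c\<in>K. expectation (\<lambda>\<omega>. (W c \<omega>)\<^sup>2)) \<le> V" and L: "0 < L"
  shows "prob {\<omega> \<in> space M. \<exists>b\<le>B. \<exists>a\<le>A. 4 * L < \<bar>\<Sum>c\<in>{c \<in> K. s c < a \<and> r c < b}. W c \<omega>\<bar>} \<le> 4 * V / L\<^sup>2"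
\<comment> \<open>A bound above 1 is trivial. Otherwise both \<open>V/L\<^sup>2\<close> and
  \<open>2 V/L\<^sup>2\<close> are at most 1/2, as the two applications demand.\<close>
proof (cases "4 * V / L\<^sup>2 \<le> 1")
  case False
  then show ?thesis using prob_le_1 by (meson le_less_trans less_imp_le not_le)
next
  case True
  have V0: "0 \<le> V" using V by (rule order_trans[rotated]) (intro sum_nonneg integral_nonneg; simp)
  have cheb: "prob {\<omega> \<in> space M. L < \<bar>\<Sum>c\<in>J. W c \<omega>\<bar>} \<le> V / L\<^sup>2" if "J \<subseteq> K" for J
  proof -
    have "prob {\<omega> \<in> space M. L < \<bar>\<Sum>c\<in>J. W c \<omega>\<bar>} \<le> (\<Sum>c\<in>J. expectation (\<lambda>\<omega>. (W c \<omega>)\<^sup>2)) / L\<^sup>2"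
      using that K by (intro indep_sum_Chebyshev indep_vars_subset[OF ind] sq cent L) (auto intro: finite_subset)
    also have "\<dots> \<le> (\<Sum>c\<in>K. expectation (\<lambda>\<omega>. (W c \<omega>)\<^sup>2)) / L\<^sup>2"
      using that K by (intro divide_right_mono sum_mono2) auto
    also have "\<dots> \<le> V / L\<^sup>2" using V by (intro divide_right_mono) auto
    finally show ?thesis .
  qed
  have one: "prob {\<omega> \<in> space M. \<exists>a\<le>A. 2 * L < \<bar>\<Sum>c\<in>{c \<in> K. s c < a \<and> b \<le> r c}. W c \<omega>\<bar>} \<le> 2 * (V / L\<^sup>2)" for b
  proof -
    have *: "{c \<in> {c \<in> K. b \<le> r c} \<inter> UNIV. s c < a} = {c \<in> K. s c < a \<and> b \<le> r c}" for a by auto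
    have "prob {\<omega> \<in> space M. \<exists>a\<le>A. \<exists>\<theta>\<in>{()}. 2 * L < \<bar>\<Sum>c\<in>{c \<in> {c \<in> K. b \<le> r c} \<inter> UNIV. s c < a}. W c \<omega>\<bar>} \<le> 2 * (V / L\<^sup>2)"
    proof (rule Ottaviani_inequality)
      show "indep_vars (\<lambda>_. borel) W {c \<in> K. b \<le> r c}" by (rule indep_vars_subset[OF ind]) auto
      show "prob {\<omega> \<in> space M. \<exists>\<theta>\<in>{()}. L < \<bar>\<Sum>c\<in>{c \<in> {c \<in> K. b \<le> r c} \<inter> UNIV. b' \<le> s c}. W c \<omega>\<bar>} \<le> V / L\<^sup>2" for b'
        using cheb[of "{c \<in> {c \<in> K. b \<le> r c} \<inter> UNIV. b' \<le> s c}"] by simp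
      show "V / L\<^sup>2 \<le> 1/2" using True V0 by simp
    qed (use K in auto)
    then show ?thesis unfolding * by simp
  qed
  have *: "{c \<in> K \<inter> {c. s c < a}. r c < b} = {c \<in> K. s c < a \<and> r c < b}"
     "{c \<in> K \<inter> {c. s c < a}. b \<le> r c} = {c \<in> K. s c < a \<and> b \<le> r c}" for a b by auto
  have "prob {\<omega> \<in> space M. \<exists>b\<le>B. \<exists>a\<in>{..A}. 2 * (2 * L) < \<bar>\<Sum>c\<in>{c \<in> K \<inter> {c. s c < a}. r c < b}. W c \<omega>\<bar>} \<le> 2 * (2 * (V / L\<^sup>2))"
  proof (rule Ottaviani_inequality[OF K _ ind])
    show "prob {\<omega> \<in> space M. \<exists>a\<in>{..A}. 2 * L < \<bar>\<Sum>c\<in>{c \<in> K \<inter> {c. s c < a}. b \<le> r c}. W c \<omega>\<bar>} \<le> 2 * (V / L\<^sup>2)" for b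
      unfolding * using one[of b] by (simp add: Bex_def)
    show "2 * (V / L\<^sup>2) \<le> 1/2" using True by simp
  qed auto
  then show ?thesis unfolding * by (simp add: Bex_def)
qed

end

section \<open>Poisson random measures\<close>

text \<open>Independence of counts is postulated for families indexed by natural numbers, while the
  cells below are indexed by triples; this lemma carries independence across an enumeration.\<close>

lemma (in prob_space) indep_vars_reindex_bij:
  assumes h: "bij_betw h I J" and ind: "indep_vars (\<lambda>i. M' (h i)) (\<lambda>i. X (h i)) I"
  shows "indep_vars M' X J"
proof -
  define g where "g = the_inv_into I h"
  have gh: "g (h i) = i" if "i \<in> I" for i
    using h that unfolding g_def by (simp add: bij_betw_def the_inv_into_f_f)
  have hg: "h (g j) = j" and gI: "g j \<in> I" if "j \<in> J" for j
    using h that gh unfolding bij_betw_def by auto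
  have rv: "random_variable (M' j) (X j)" if "j \<in> J" for j
    using ind gI[OF that] hg[OF that] unfolding indep_vars_def by metis
  have "indep_sets (\<lambda>j. {X j -` A \<inter> space M |A. A \<in> sets (M' j)}) J"
  proof (rule indep_setsI)
    show "{X j -` A \<inter> space M |A. A \<in> sets (M' j)} \<subseteq> events" if "j \<in> J" for j
      using rv[OF that] by (auto intro: measurable_sets)
  next
    fix A J' assume J': "J' \<noteq> {}" "J' \<subseteq> J" "finite J'"
      and A: "\<forall>j\<in>J'. A j \<in> {X j -` A \<inter> space M |A. A \<in> sets (M' j)}"
    have inj: "inj_on g J'" using J' hg by (metis inj_on_def subset_iff)
    have iset: "indep_sets (\<lambda>i. {X (h i) -` A \<inter> space M |A. A \<in> sets (M' (h i))}) I"
      using ind unfolding indep_vars_def2 by simp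
    have "prob (\<Inter>i\<in>g ` J'. A (h i)) = (\<Prod>i\<in>g ` J'. prob (A (h i)))"
      by (rule indep_setsD[OF iset]) (use J' A gI hg in auto)
    also have "(\<Inter>i\<in>g ` J'. A (h i)) = (\<Inter>j\<in>J'. A j)" using J' hg by (auto simp: subset_iff)
    also have "(\<Prod>i\<in>g ` J'. prob (A (h i))) = (\<Prod>j\<in>J'. prob (A j))"
      using inj J' hg by (subst prod.reindex) (auto intro!: prod.cong simp: subset_iff)
    finally show "prob (\<Inter>j\<in>J'. A j) = (\<Prod>j\<in>J'. prob (A j))" .
  qed
  then show ?thesis unfolding indep_vars_def2 using rv by blast
qed

text \<open>The Poisson weights satisfy \<open>(k + 1) p (k + 1) = m p k\<close>, so each factorial
  moment is a shifted copy of the previous one, multiplied by \<open>m\<close>.\<close>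

lemma Poisson_sums:
  fixes m :: real
  defines "p \<equiv> \<lambda>k. exp (- m) * m ^ k / fact k"
  shows "p sums 1" and "(\<lambda>k. real k * p k) sums m" and "(\<lambda>k. (real k - m)\<^sup>2 * p k) sums m"
proof -
  have "(\<lambda>k. exp (- m) * (m ^ k /\<^sub>R fact k)) sums (exp (- m) * exp m)"
    by (intro sums_mult exp_converges)
  then show p: "p sums 1" by (simp add: p_def exp_minus divide_inverse ac_simps)
  have step: "real (Suc k) * p (Suc k) = m * p k" for k
    by (simp add: p_def divide_simps)
  have "(\<lambda>k. real (Suc k) * p (Suc k)) sums (m * 1)" unfolding step by (intro sums_mult p)
  then show p1: "(\<lambda>k. real k * p k) sums m" by (subst (asm) sums_Suc_iff) simp
  have step2: "real (Suc k) * (real (Suc k) - 1) * p (Suc k) = m * (real k * p k)" for k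
    using arg_cong[OF step[of k], of "(*) (real k)"] by (simp add: ac_simps)
  have "(\<lambda>k. real (Suc k) * (real (Suc k) - 1) * p (Suc k)) sums (m * m)"
    unfolding step2 by (intro sums_mult p1)
  then have p2: "(\<lambda>k. real k * (real k - 1) * p k) sums (m * m)" by (subst (asm) sums_Suc_iff) simp
  \<comment> \<open>This recombines the factorial moments through
    \<open>(k - m)\<^sup>2 = k (k - 1) + (1 - 2 m) k + m\<^sup>2\<close>.\<close>
  have "(\<lambda>k. real k * (real k - 1) * p k + (1 - 2 * m) * (real k * p k) + m\<^sup>2 * p k)
      sums (m * m + (1 - 2 * m) * m + m\<^sup>2 * 1)"
    by (intro sums_add sums_mult p p1 p2)
  then show "(\<lambda>k. (real k - m)\<^sup>2 * p k) sums m"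
    by (simp add: power2_eq_square algebra_simps)
qed

locale poisson_jumps = prob_space M for M :: "'w measure" +
  fixes N :: "'w \<Rightarrow> ((real \<times> real) \<times> real) measure" and l :: "real measure"
  assumes levy: "levy_measure l" and prm: "poisson_random_measure M N l"
begin

lemma sets_l [simp, measurable_cong]: "sets l = sets borel"
  using levy by (simp add: levy_measure_def)

lemma space_l [simp]: "space l = UNIV"
  using sets_eq_imp_space_eq[OF sets_l] by simp

lemma sets_intensity [simp, measurable_cong]: "sets (intensity l) = sets borel"
proof -
  have "sets (intensity l) = sets ((borel :: (real \<times> real) measure) \<Otimes>\<^sub>M (borel :: real measure))"
    unfolding intensity_def by (intro sets_pair_measure_cong) simp_all
  then show ?thesis unfolding borel_prod .
qed

lemma space_intensity [simp]: "space (intensity l) = UNIV"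
  using sets_eq_imp_space_eq[OF sets_intensity] by simp

lemma sets_N [simp]: "\<omega> \<in> space M \<Longrightarrow> sets (N \<omega>) = sets borel"
  using prm by (simp add: poisson_random_measure_def)

lemma space_N [simp]: "\<omega> \<in> space M \<Longrightarrow> space (N \<omega>) = UNIV"
  using sets_eq_imp_space_eq[OF sets_N] by simp

lemma measurable_emeasure_N: "C \<in> sets borel \<Longrightarrow> (\<lambda>\<omega>. emeasure (N \<omega>) C) \<in> borel_measurable M"
  using prm unfolding poisson_random_measure_def sets_intensity by blast

lemma measurable_measure_N: "C \<in> sets borel \<Longrightarrow> (\<lambda>\<omega>. measure (N \<omega>) C) \<in> borel_measurable M"
  unfolding measure_def by (intro borel_measurable_enn2real measurable_emeasure_N)

lemma nn_integral_min: "(\<integral>\<^sup>+ y. ennreal (min 1 (y\<^sup>2)) \<partial>l) < \<infinity>"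
  using levy by (simp add: levy_measure_def)

text \<open>Markov's inequality: on this set \<open>min 1 (y\<^sup>2)\<close> is at least
  \<open>min 1 (e\<^sup>2)\<close>.\<close>

lemma emeasure_l_outside: 
  assumes "0 < e" shows "emeasure l {y. e < \<bar>y\<bar>} < \<infinity>"
proof -
  define c where "c = min 1 (e\<^sup>2)"
  have c: "0 < c" using assms by (simp add: c_def)
  have "emeasure l {y. e < \<bar>y\<bar>} = (\<integral>\<^sup>+ y. indicator {y. e < \<bar>y\<bar>} y \<partial>l)"
    by (rule nn_integral_indicator[symmetric]) measurable
  also have "\<dots> \<le> (\<integral>\<^sup>+ y. ennreal (1 / c) * ennreal (min 1 (y\<^sup>2)) \<partial>l)"
  proof (intro nn_integral_mono)
    fix y :: real
    show "indicator {y. e < \<bar>y\<bar>} y \<le> ennreal (1 / c) * ennreal (min 1 (y\<^sup>2))"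
    proof (cases "e < \<bar>y\<bar>")
      case True
      then have "e\<^sup>2 \<le> y\<^sup>2" using assms by (metis abs_ge_self abs_le_square_iff abs_of_pos less_imp_le)
      then have "1 \<le> (1 / c) * min 1 (y\<^sup>2)" using c by (auto simp: c_def field_simps)
      then show ?thesis using True c by (simp flip: ennreal_mult)
    qed auto
  qed
  also have "\<dots> = ennreal (1 / c) * (\<integral>\<^sup>+ y. ennreal (min 1 (y\<^sup>2)) \<partial>l)"
    by (rule nn_integral_cmult) measurable
  also have "\<dots> < \<infinity>" using nn_integral_min by (simp add: ennreal_mult_less_top)
  finally show ?thesis .
qed

lemma sigma_finite_l: "sigma_finite_measure l"
proof
  define F where "F n = {y :: real. 1 / real (Suc n) < \<bar>y\<bar>}" for n
  have "(\<Union>n. F n) \<union> {0} = UNIV"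
  proof -
    have "y \<in> (\<Union>n. F n)" if "y \<noteq> 0" for y
      using that reals_Archimedean[of "\<bar>y\<bar>"] by (auto simp: F_def inverse_eq_divide)
    then show ?thesis by auto
  qed
  moreover have "emeasure l (F n) \<noteq> \<infinity>" for n
    using emeasure_l_outside[of "1 / real (Suc n)"] unfolding F_def by simp
  moreover have "emeasure l {0} \<noteq> \<infinity>" using levy by (simp add: levy_measure_def)
  moreover have "F n \<in> sets l" for n unfolding F_def by (simp, measurable)
  ultimately show "\<exists>A. countable A \<and> A \<subseteq> sets l \<and> \<Union> A = space l \<and> (\<forall>a\<in>A. emeasure l a \<noteq> \<infinity>)"
    by (intro exI[of _ "insert {0} (range F)"]) auto
qed

lemma emeasure_intensity_Times:
  assumes "U \<in> sets borel" "E \<in> sets borel"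
  shows "emeasure (intensity l) (U \<times> E) = emeasure lborel U * emeasure l E"
proof -
  interpret sigma_finite_measure l by (rule sigma_finite_l)
  show ?thesis unfolding intensity_def using assms by (intro emeasure_pair_measure_Times) auto
qed

lemma Times_borel: 
  fixes U :: "(real \<times> real) set" and E :: "real set"
  assumes "U \<in> sets borel" "E \<in> sets borel" shows "U \<times> E \<in> sets borel"
  using pair_measureI[OF assms] unfolding borel_prod .

text \<open>A realisation of \<open>N\<close> is just some measure. That its counts are integers is
  a consequence of the law: the Poisson weights already sum to 1, leaving no probability for other
  values.\<close>

lemma N_nat_valued:
  assumes C: "C \<in> sets borel" "emeasure (intensity l) C < \<infinity>"
  shows "AE \<omega> in M. \<exists>k. emeasure (N \<omega>) C = of_nat k"
proof -
  define A where "A k = {\<omega> \<in> space M. emeasure (N \<omega>) C = of_nat k}" for k :: nat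
  note [measurable] = measurable_emeasure_N[OF C(1)]
  have A: "A k \<in> events" for k unfolding A_def by measurable
  have p: "prob (A k) = exp (- measure (intensity l) C) * measure (intensity l) C ^ k / fact k" for k
    using prm C unfolding poisson_random_measure_def A_def by simp
  have "disjoint_family A" by (auto simp: A_def disjoint_family_on_def)
  then have "(\<lambda>k. prob (A k)) sums prob (\<Union>k. A k)" using A by (intro finite_measure_UNION) auto
  then have "prob (\<Union>k. A k) = 1"
    using Poisson_sums(1)[of "measure (intensity l) C"] unfolding p by (rule sums_unique2)
  then have "AE \<omega> in M. \<omega> \<in> (\<Union>k. A k)" using A by (intro AE_prob_1) auto
  then show ?thesis by eventually_elim (auto simp: A_def)
qed

lemma N_finite:
  assumes C: "C \<in> sets borel" "emeasure (intensity l) C < \<infinity>"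
  shows "AE \<omega> in M. emeasure (N \<omega>) C < \<infinity>"
  using N_nat_valued[OF C] by eventually_elim (auto simp: of_nat_less_top)

text \<open>The expectation is a series over the atoms of the count. Nonnegativity of
  \<open>h\<close> is asked at natural numbers only, which admits the identity function for the mean
  beside the squared deviation for the variance.\<close>

lemma N_expectation_of_sums:
  fixes h :: "real \<Rightarrow> real"
  assumes C: "C \<in> sets borel" "emeasure (intensity l) C < \<infinity>"
    and h: "h \<in> borel_measurable borel" "\<And>k::nat. 0 \<le> h k"
    and s: "(\<lambda>k. h k * (exp (- measure (intensity l) C) * measure (intensity l) C ^ k / fact k)) sums s"
  shows "has_bochner_integral M (\<lambda>\<omega>. h (measure (N \<omega>) C)) s"
proof -
  define A where "A k = {\<omega> \<in> space M. emeasure (N \<omega>) C = of_nat k}" for k :: nat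
  define p where "p k = exp (- measure (intensity l) C) * measure (intensity l) C ^ k / fact k" for k :: nat
  note [measurable] = measurable_emeasure_N[OF C(1)] measurable_measure_N[OF C(1)] h(1)
  have A [measurable]: "A k \<in> events" for k unfolding A_def by measurable
  have p: "prob (A k) = p k" for k
    using prm C unfolding poisson_random_measure_def A_def p_def by simp
  have p0: "0 \<le> p k" for k unfolding p_def by simp
  have eq: "AE \<omega> in M. ennreal (h (measure (N \<omega>) C)) = (\<Sum>k. ennreal (h k) * indicator (A k) \<omega>)"
    using N_nat_valued[OF C] AE_space
  proof eventually_elim
    case (elim \<omega>)
    then obtain k where k: "emeasure (N \<omega>) C = of_nat k" by auto
    have "(\<Sum>j. ennreal (h j) * indicator (A j) \<omega>) = (\<Sum>j\<in>{k}. ennreal (h j) * indicator (A j) \<omega>)"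
      by (rule suminf_finite) (auto simp: A_def k)
    also have "\<dots> = ennreal (h k)" using elim k by (simp add: A_def)
    finally show ?case using k by (simp add: measure_def)
  qed
  have "(\<integral>\<^sup>+\<omega>. ennreal (h (measure (N \<omega>) C)) \<partial>M) = (\<integral>\<^sup>+\<omega>. (\<Sum>k. ennreal (h k) * indicator (A k) \<omega>) \<partial>M)"
    by (rule nn_integral_cong_AE[OF eq])
  also have "\<dots> = (\<Sum>k. \<integral>\<^sup>+\<omega>. ennreal (h k) * indicator (A k) \<omega> \<partial>M)"
    by (rule nn_integral_suminf) measurable
  also have "\<dots> = (\<Sum>k. ennreal (h k * p k))"
    using h(2) p0 by (intro suminf_cong) (simp add: nn_integral_cmult_indicator emeasure_eq_measure p ennreal_mult)
  also have "\<dots> = ennreal s"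
    using s h(2) p0 unfolding p_def[symmetric] by (intro suminf_ennreal_eq) auto
  finally have nn: "(\<integral>\<^sup>+\<omega>. ennreal (h (measure (N \<omega>) C)) \<partial>M) = ennreal s" .
  have s0: "0 \<le> s" using sums_le[OF _ sums_zero s] h(2) p0 unfolding p_def[symmetric] by simp
  have "AE \<omega> in M. 0 \<le> h (measure (N \<omega>) C)"
    using N_nat_valued[OF C] by eventually_elim (auto simp: measure_def h(2))
  then show ?thesis using nn s0 by (intro has_bochner_integral_nn_integral) auto
qed

lemma N_compensated_moments:
  assumes C: "C \<in> sets borel" "emeasure (intensity l) C < \<infinity>"
  shows "integrable M (\<lambda>\<omega>. (measure (N \<omega>) C - measure (intensity l) C)\<^sup>2)"
    and "expectation (\<lambda>\<omega>. (measure (N \<omega>) C - measure (intensity l) C)\<^sup>2) = measure (intensity l) C"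
    and "expectation (\<lambda>\<omega>. measure (N \<omega>) C - measure (intensity l) C) = 0"
proof -
  have 2: "has_bochner_integral M (\<lambda>\<omega>. (measure (N \<omega>) C - measure (intensity l) C)\<^sup>2) (measure (intensity l) C)"
    by (rule N_expectation_of_sums[OF C, where h="\<lambda>x. (x - measure (intensity l) C)\<^sup>2"]) (simp_all only: Poisson_sums(3), simp_all)
  have 1: "has_bochner_integral M (\<lambda>\<omega>. measure (N \<omega>) C) (measure (intensity l) C)"
    by (rule N_expectation_of_sums[OF C, where h="\<lambda>x. x"]) (simp_all only: Poisson_sums(2), simp_all)
  show "integrable M (\<lambda>\<omega>. (measure (N \<omega>) C - measure (intensity l) C)\<^sup>2)"
    and "expectation (\<lambda>\<omega>. (measure (N \<omega>) C - measure (intensity l) C)\<^sup>2) = measure (intensity l) C"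
    using 2 by (auto simp: has_bochner_integral_iff)
  show "expectation (\<lambda>\<omega>. measure (N \<omega>) C - measure (intensity l) C) = 0"
    using 1 by (simp add: has_bochner_integral_iff prob_space)
qed

lemma N_indep:
  assumes K: "finite K" and disj: "disjoint_family_on C K" and C: "\<And>c. c \<in> K \<Longrightarrow> C c \<in> sets borel"
  shows "indep_vars (\<lambda>_. borel) (\<lambda>c \<omega>. emeasure (N \<omega>) (C c)) K"
proof -
  obtain h where h: "bij_betw h {0..<card K} K" using ex_bij_betw_nat_finite[OF K] by auto
  then have hK: "h i \<in> K" if "i \<in> {0..<card K}" for i using that by (auto simp: bij_betw_def)
  have "disjoint_family_on (\<lambda>i. C (h i)) {0..<card K}"
    using disj h hK unfolding disjoint_family_on_def bij_betw_def inj_on_def by metis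
  then have "indep_vars (\<lambda>_. borel) (\<lambda>i \<omega>. emeasure (N \<omega>) (C (h i))) {0..<card K}"
    using prm C hK unfolding poisson_random_measure_def by simp
  then show ?thesis by (intro indep_vars_reindex_bij[OF h])
qed

text \<open>Counts of Borel sets are random variables by definition; simple functions and monotone
  limits extend this to all nonnegative Borel integrands.\<close>

lemma measurable_nn_integral_N:
  assumes "f \<in> borel_measurable borel"
  shows "(\<lambda>\<omega>. \<integral>\<^sup>+p. f p \<partial>N \<omega>) \<in> borel_measurable M"
  using assms
proof (induction rule: borel_measurable_induct)
  case (cong f g)
  then have "f = g" by auto
  then show ?case using cong by simp
next
  case (set A)
  have "(\<integral>\<^sup>+p. indicator A p \<partial>N \<omega>) = emeasure (N \<omega>) A" if "\<omega> \<in> space M" for \<omega>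
    using set that by (intro nn_integral_indicator) simp
  then show ?case using measurable_emeasure_N[OF set] by (subst measurable_cong)
next
  case (mult u c)
  have "(\<integral>\<^sup>+p. c * u p \<partial>N \<omega>) = c * (\<integral>\<^sup>+p. u p \<partial>N \<omega>)" if "\<omega> \<in> space M" for \<omega>
    using mult.hyps that by (intro nn_integral_cmult) (simp cong: measurable_cong_sets)
  then show ?case using mult.IH by (subst measurable_cong[where g="\<lambda>\<omega>. c * (\<integral>\<^sup>+p. u p \<partial>N \<omega>)"]) auto
next
  case (add u v)
  have "(\<integral>\<^sup>+p. v p + u p \<partial>N \<omega>) = (\<integral>\<^sup>+p. v p \<partial>N \<omega>) + (\<integral>\<^sup>+p. u p \<partial>N \<omega>)" if "\<omega> \<in> space M" for \<omega>
    using add.hyps that by (intro nn_integral_add) (simp_all cong: measurable_cong_sets)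
  then show ?case using add.IH by (subst measurable_cong[where g="\<lambda>\<omega>. (\<integral>\<^sup>+p. v p \<partial>N \<omega>) + (\<integral>\<^sup>+p. u p \<partial>N \<omega>)"]) auto
next
  case (seq U)
  have eq: "(\<integral>\<^sup>+p. (SUP i. U i) p \<partial>N \<omega>) = (SUP i. \<integral>\<^sup>+p. U i p \<partial>N \<omega>)" if "\<omega> \<in> space M" for \<omega>
    unfolding SUP_apply
    using seq.hyps that by (intro nn_integral_monotone_convergence_SUP) (simp_all cong: measurable_cong_sets)
  show ?case
    by (subst measurable_cong[OF eq], assumption, intro borel_measurable_SUP seq.IH) simp
qed

lemma measurable_integral_N:
  fixes f :: "(real \<times> real) \<times> real \<Rightarrow> real"
  assumes [measurable]: "f \<in> borel_measurable borel"
  shows "(\<lambda>\<omega>. \<integral>p. f p \<partial>N \<omega>) \<in> borel_measurable M"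
proof -
  have f: "f \<in> borel_measurable (N \<omega>)" if "\<omega> \<in> space M" for \<omega>
    using assms that by (subst measurable_cong_sets[OF sets_N refl])
  \<comment> \<open>Whether \<open>f\<close> is integrable depends on the realisation, and the
    Bochner integral is 0 where it is not. The case distinction is written with nonnegative
    integrals, whose measurability is known.\<close>
  have eq: "(\<integral>p. f p \<partial>N \<omega>) = (if (\<integral>\<^sup>+p. ennreal (norm (f p)) \<partial>N \<omega>) < \<infinity>
      then enn2real (\<integral>\<^sup>+p. ennreal (f p) \<partial>N \<omega>) - enn2real (\<integral>\<^sup>+p. ennreal (- f p) \<partial>N \<omega>) else 0)"
    if "\<omega> \<in> space M" for \<omega>
  proof (cases "integrable (N \<omega>) f")
    case True
    then show ?thesis using real_lebesgue_integral_def[OF True] by (simp add: integrable_iff_bounded)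
  next
    case False
    then show ?thesis using not_integrable_integral_eq[OF False] f[OF that] by (simp add: integrable_iff_bounded)
  qed
  have meas: "(\<lambda>\<omega>. if a \<omega> < \<infinity> then enn2real (b \<omega>) - enn2real (c \<omega>) else 0) \<in> borel_measurable M"
    if [measurable]: "a \<in> borel_measurable M" "b \<in> borel_measurable M" "c \<in> borel_measurable M"
    for a b c :: "'w \<Rightarrow> ennreal"
    by measurable
  show ?thesis
    by (subst measurable_cong[OF eq], assumption, intro meas measurable_nn_integral_N measurable_compose[OF _ measurable_ennreal]
        measurable_compose[OF assms borel_measurable_norm] borel_measurable_uminus assms)
qed

end

section \<open>Discretised compensated integrals\<close>

text \<open>Open inside and closed outside: shells between successive levels tile without overlap,
  and \<open>shell u v\<close> is exactly what \<open>small_jumps u\<close> has in addition to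
  \<open>small_jumps v\<close> when \<open>0 < u \<le> v < 1\<close>.\<close>

definition shell :: "real \<Rightarrow> real \<Rightarrow> real set" where
  "shell u v = {y. u < \<bar>y\<bar> \<and> \<bar>y\<bar> \<le> v}"

lemma shell_borel [measurable, simp]: "shell u v \<in> sets borel"
  unfolding shell_def by measurable

text \<open>The cell \<open>(i, n, q)\<close> collects the \<open>i\<close>-th increment of \<open>U\<close> and the jump sizes in the \<open>n\<close>-th shell
  that are rounded down to \<open>q / k\<close>.\<close>
definition cell :: "(nat \<Rightarrow> (real \<times> real) set) \<Rightarrow> (nat \<Rightarrow> real) \<Rightarrow> nat \<Rightarrow> nat \<times> nat \<times> int \<Rightarrow> ((real \<times> real) \<times> real) set" where
  "cell U e k = (\<lambda>(i, n, q). disjointed U i \<times> {y \<in> shell (e (Suc n)) (e n). \<lfloor>real k * y\<rfloor> = q})"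

lemma sum_indicator_disjointed:
  assumes "mono U"
  shows "(\<Sum>i\<le>a. indicator (disjointed U i) z :: real) = indicator (U a) z"
proof (induction a)
  case 0
  then show ?case by (simp add: disjointed_def)
next
  case (Suc a)
  have "U a \<subseteq> U (Suc a)" using assms by (simp add: mono_def)
  then show ?case using Suc disjointed_mono[OF assms] by (auto simp: indicator_def)
qed

lemma sum_indicator_shell:
  assumes "decseq e"
  shows "(\<Sum>n<b. indicator (shell (e (Suc n)) (e n)) y :: real) = indicator (shell (e b) (e 0)) y"
proof (induction b)
  case 0
  then show ?case by (simp add: shell_def)
next
  case (Suc b)
  have "e b \<le> e 0" "e (Suc b) \<le> e b" using assms by (simp_all add: decseq_def)
  then show ?case using Suc by (auto simp: indicator_def shell_def)
qed

text \<open>Jump sizes are at most 1 in modulus, so rounding with mesh \<open>1/k\<close> uses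
  finitely many values and finitely many cells suffice.\<close>

lemma floor_bounds:
  assumes "\<bar>y\<bar> \<le> (1::real)" shows "\<lfloor>real k * y\<rfloor> \<in> {- int k..int k}"
proof -
  have "\<bar>real k * y\<bar> \<le> real k" using assms by (simp add: abs_mult mult_left_le)
  then show ?thesis by (auto simp: abs_le_iff le_floor_iff floor_le_iff)
qed

lemma floor_approx:
  assumes "0 < k" shows "\<bar>\<lfloor>real k * y\<rfloor> / real k - y\<bar> \<le> 1 / real k"
proof -
  have "\<bar>\<lfloor>real k * y\<rfloor> - real k * y\<bar> \<le> 1" by linarith
  then have "\<bar>\<lfloor>real k * y\<rfloor> - real k * y\<bar> / real k \<le> 1 / real k" by (intro divide_right_mono) auto
  moreover have "\<lfloor>real k * y\<rfloor> / real k - y = (\<lfloor>real k * y\<rfloor> - real k * y) / real k"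
    using assms by (simp add: field_simps)
  ultimately show ?thesis by (simp add: abs_divide)
qed

text \<open>The indicator of a cell is a product of one factor per index, so the triple sum splits
  into three sums: two telescope and the third selects the rounded jump size. The weight
  \<open>w\<close> is kept general because \<open>q/k\<close> gives the integral and its square
  gives the variance.\<close>

lemma cell_indicator_sum:
  fixes w :: "int \<Rightarrow> real"
  assumes "mono U" "decseq e" "e 0 \<le> 1"
  shows "(\<Sum>c\<in>{..a} \<times> {..<b} \<times> {- int k..int k}. w (snd (snd c)) * indicator (cell U e k c) p)
    = indicator (U a \<times> shell (e b) (e 0)) p * w \<lfloor>real k * snd p\<rfloor>"
proof -
  obtain z y where p: "p = (z, y)" by (cases p)
  have ic: "indicator (cell U e k (i, n, q)) p =
      (indicator (disjointed U i) z * (indicator (shell (e (Suc n)) (e n)) y * (if \<lfloor>real k * y\<rfloor> = q then 1 else 0)) :: real)" for i n q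
    by (auto simp: cell_def p indicator_def)
  have "(\<Sum>c\<in>{..a} \<times> {..<b} \<times> {- int k..int k}. w (snd (snd c)) * indicator (cell U e k c) p)
    = (\<Sum>i\<le>a. \<Sum>n<b. \<Sum>q\<in>{- int k..int k}. w q * indicator (cell U e k (i, n, q)) p)"
    unfolding sum.cartesian_product by (intro sum.cong refl) (auto simp: split_def)
  also have "\<dots> = (\<Sum>i\<le>a. indicator (disjointed U i) z) * ((\<Sum>n<b. indicator (shell (e (Suc n)) (e n)) y) *
      (\<Sum>q\<in>{- int k..int k}. if \<lfloor>real k * y\<rfloor> = q then w q else 0))"
    unfolding ic unfolding sum_product unfolding sum_distrib_left
    by (intro sum.cong refl) auto
  also have "\<dots> = indicator (U a) z * (indicator (shell (e b) (e 0)) y *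
      (if \<lfloor>real k * y\<rfloor> \<in> {- int k..int k} then w \<lfloor>real k * y\<rfloor> else 0))"
    unfolding sum_indicator_disjointed[OF assms(1)] sum_indicator_shell[OF assms(2)] by (subst sum.delta') auto
  also have "\<dots> = indicator (U a \<times> shell (e b) (e 0)) p * w \<lfloor>real k * snd p\<rfloor>"
  proof (cases "y \<in> shell (e b) (e 0)")
    case True
    then have "\<bar>y\<bar> \<le> 1" using assms(3) by (simp add: shell_def)
    from floor_bounds[OF this, of k] show ?thesis by (simp add: p indicator_def)
  next
    case False
    then show ?thesis by (simp add: p)
  qed
  finally show ?thesis .
qed

lemma cell_disjoint:
  assumes "mono U" "decseq e"
  shows "disjoint_family_on (cell U e k) K"
  unfolding disjoint_family_on_def
proof (intro ballI impI)
  fix c c' :: "nat \<times> nat \<times> int" assume "c \<noteq> c'"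
  obtain i n q i' n' q' where c: "c = (i, n, q)" "c' = (i', n', q')" by (cases c; cases c')
  have sh: "shell (e (Suc n)) (e n) \<inter> shell (e (Suc n')) (e n') = {}" if "n < n'" for n n'
  proof -
    have "e n' \<le> e (Suc n)" using that assms(2) by (simp add: decseq_def)
    then show ?thesis by (auto simp: shell_def)
  qed
  have sh': "shell (e (Suc n)) (e n) \<inter> shell (e (Suc n')) (e n') = {}" if "n \<noteq> n'"
    using sh[of n n'] sh[of n' n] that by (cases n n' rule: linorder_cases) auto
  have dj: "disjointed U i \<inter> disjointed U i' = {}" if "i \<noteq> i'"
    using disjoint_family_disjointed[of U] that by (auto simp: disjoint_family_on_def)
  consider "i \<noteq> i'" | "n \<noteq> n'" | "q \<noteq> q'" using \<open>c \<noteq> c'\<close> c by auto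
  then show "cell U e k c \<inter> cell U e k c' = {}"
    unfolding c cell_def using sh' dj by cases auto
qed

lemma bounded_integrable_on:
  fixes f :: "'b \<Rightarrow> real"
  assumes C: "C \<in> sets \<mu>" "emeasure \<mu> C < \<infinity>" and f: "f \<in> borel_measurable \<mu>"
    and b: "\<And>p. p \<in> C \<Longrightarrow> \<bar>f p\<bar> \<le> c"
  shows "integrable \<mu> (\<lambda>p. indicator C p * f p)"
proof (rule integrableI_bounded_set[where A=C and B=c])
  show "AE x in \<mu>. x \<in> C \<longrightarrow> norm (indicator C x * f x) \<le> c" using b by (auto simp: indicator_def)
qed (use C f in \<open>auto simp: indicator_def\<close>)

lemma integral_diff_le_on:
  fixes f g :: "'b \<Rightarrow> real"
  assumes C: "C \<in> sets \<mu>" "emeasure \<mu> C < \<infinity>"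
    and f: "integrable \<mu> (\<lambda>p. indicator C p * f p)" and g: "integrable \<mu> (\<lambda>p. indicator C p * g p)"
    and b: "\<And>p. p \<in> C \<Longrightarrow> \<bar>f p - g p\<bar> \<le> d"
  shows "\<bar>(\<integral>p. indicator C p * f p \<partial>\<mu>) - (\<integral>p. indicator C p * g p \<partial>\<mu>)\<bar> \<le> d * measure \<mu> C"
proof -
  have int: "integrable \<mu> (\<lambda>p. d * indicator C p)" using C by (intro integrable_mult_right integrable_real_indicator) auto
  have "\<bar>(\<integral>p. indicator C p * f p \<partial>\<mu>) - (\<integral>p. indicator C p * g p \<partial>\<mu>)\<bar>
      = \<bar>\<integral>p. indicator C p * f p - indicator C p * g p \<partial>\<mu>\<bar>"
    using f g by simp
  also have "\<dots> \<le> (\<integral>p. \<bar>indicator C p * f p - indicator C p * g p\<bar> \<partial>\<mu>)" by (rule integral_abs_bound)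
  also have "\<dots> \<le> (\<integral>p. d * indicator C p \<partial>\<mu>)"
    using f g b by (intro integral_mono integrable_abs Bochner_Integration.integrable_diff int) (auto simp: indicator_def)
  also have "\<dots> = d * measure \<mu> C" using C by (simp add: sets.Int_space_eq2)
  finally show ?thesis .
qed

section \<open>Variance bound and maximal inequality for rounded jump sizes\<close>

context poisson_jumps begin

definition compensated :: "((real \<times> real) \<times> real \<Rightarrow> real) \<Rightarrow> 'w \<Rightarrow> real" where
  "compensated f \<omega> = (\<integral>p. f p \<partial>N \<omega>) - (\<integral>p. f p \<partial>intensity l)"

lemma compensated_measurable [measurable]:
  "f \<in> borel_measurable borel \<Longrightarrow> compensated f \<in> borel_measurable M"
  unfolding compensated_def using measurable_integral_N[of f] by simp

definition small_var :: "real \<Rightarrow> real" where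
  "small_var h = (\<integral>y. indicator {y. \<bar>y\<bar> \<le> h} y * y\<^sup>2 \<partial>l)"

lemma small_var_integrable:
  assumes "h \<le> 1" shows "integrable l (\<lambda>y. indicator {y. \<bar>y\<bar> \<le> h} y * y\<^sup>2)"
proof (rule Bochner_Integration.integrable_bound)
  show "integrable l (\<lambda>y. min 1 (y\<^sup>2))"
    using nn_integral_min by (intro integrableI_nonneg) auto
  show "AE y in l. norm (indicator {y. \<bar>y\<bar> \<le> h} y * y\<^sup>2) \<le> norm (min 1 (y\<^sup>2))"
  proof (rule AE_I2)
    fix y :: real
    have "y\<^sup>2 \<le> 1" if "\<bar>y\<bar> \<le> h" using that assms by (simp add: abs_square_le_1)
    then show "norm (indicator {y. \<bar>y\<bar> \<le> h} y * y\<^sup>2) \<le> norm (min 1 (y\<^sup>2))" by (auto simp: indicator_def)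
  qed
qed measurable

lemma small_var_tendsto:
  assumes "h \<longlonglongrightarrow> 0" "\<And>n. h n \<le> 1"
  shows "(\<lambda>n. small_var (h n)) \<longlonglongrightarrow> 0"
proof -
  have "(\<lambda>n. \<integral>y. indicator {y. \<bar>y\<bar> \<le> h n} y * y\<^sup>2 \<partial>l) \<longlonglongrightarrow> (\<integral>y. 0 \<partial>l)"
  proof (rule integral_dominated_convergence[where w="\<lambda>y. indicator {y. \<bar>y\<bar> \<le> 1} y * y\<^sup>2"])
    show "integrable l (\<lambda>y. indicator {y. \<bar>y\<bar> \<le> 1} y * y\<^sup>2)" by (rule small_var_integrable) simp
    show "AE y in l. (\<lambda>n. indicator {y. \<bar>y\<bar> \<le> h n} y * y\<^sup>2) \<longlonglongrightarrow> 0"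
    proof (rule AE_I2)
      fix y :: real
      show "(\<lambda>n. indicator {y. \<bar>y\<bar> \<le> h n} y * y\<^sup>2) \<longlonglongrightarrow> 0"
      \<comment> \<open>At the origin the indicator may stay equal to 1, but the factor
        \<open>y\<^sup>2\<close> vanishes there.\<close>
      proof (cases "y = 0")
        case False
        then have "eventually (\<lambda>n. h n < \<bar>y\<bar>) sequentially" using assms(1) by (intro order_tendstoD) auto
        then have "eventually (\<lambda>n. indicator {y. \<bar>y\<bar> \<le> h n} y * y\<^sup>2 = 0) sequentially"
          by eventually_elim auto
        then show ?thesis by (rule tendsto_eventually)
      qed auto
    qed
    show "AE y in l. norm (indicator {y. \<bar>y\<bar> \<le> h n} y * y\<^sup>2) \<le> indicator {y. \<bar>y\<bar> \<le> 1} y * y\<^sup>2" for n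
      using assms(2)[of n] by (intro AE_I2) (auto simp: indicator_def)
  qed measurable
  then show ?thesis unfolding small_var_def by simp
qed

lemma small_var_nonneg: "0 \<le> small_var h"
  unfolding small_var_def by (intro Bochner_Integration.integral_nonneg) auto

lemma emeasure_strip_finite:
  assumes "U \<in> sets borel" "emeasure lborel U < \<infinity>" "0 < u" "E \<in> sets borel" "E \<subseteq> {y. u < \<bar>y\<bar>}"
  shows "emeasure (intensity l) (U \<times> E) < \<infinity>"
proof -
  have "emeasure l E \<le> emeasure l {y. u < \<bar>y\<bar>}" using assms by (intro emeasure_mono) auto
  then show ?thesis
    using assms emeasure_l_outside[OF assms(3)]
    by (auto simp: emeasure_intensity_Times ennreal_mult_less_top)
qed

lemma cell_sets [measurable]:
  assumes "\<And>i. U i \<in> sets borel"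
  shows "cell U e k c \<in> sets borel"
proof -
  obtain i n q where c: "c = (i, n, q)" by (cases c)
  have "disjointed U i \<in> sets borel" using assms unfolding disjointed_def by (intro sets.Diff sets.finite_UN) auto
  moreover have "{y \<in> shell (e (Suc n)) (e n). \<lfloor>real k * y\<rfloor> = q} \<in> sets borel"
    unfolding shell_def by measurable
  ultimately show ?thesis unfolding c cell_def by (simp add: Times_borel)
qed

text \<open>The measure is a parameter because the identity is applied twice, to a realisation of
  \<open>N\<close> and to its intensity, whose difference is the compensated integral.\<close>

lemma cell_sum_integral:
  fixes w :: "int \<Rightarrow> real"
  assumes U: "mono U" "\<And>i. U i \<in> sets borel" and e: "decseq e" "e 0 \<le> 1"
    and \<mu>: "sets \<mu> = sets borel" and fin: "emeasure \<mu> (U a \<times> shell (e b) (e 0)) < \<infinity>"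
  shows "(\<Sum>c\<in>{..a} \<times> {..<b} \<times> {- int k..int k}. w (snd (snd c)) * measure \<mu> (cell U e k c))
    = (\<integral>p. indicator (U a \<times> shell (e b) (e 0)) p * w \<lfloor>real k * snd p\<rfloor> \<partial>\<mu>)"
proof -
  let ?K = "{..a} \<times> {..<b} \<times> {- int k..int k}"
  have sub: "cell U e k c \<subseteq> U a \<times> shell (e b) (e 0)" if "c \<in> ?K" for c
  proof -
    obtain i n q where c: "c = (i, n, q)" by (cases c)
    have "U i \<subseteq> U a" "e n \<le> e 0" "e b \<le> e (Suc n)" using U(1) e(1) that c by (auto simp: mono_def decseq_def)
    then show ?thesis using disjointed_subset[of U i] by (auto simp: c cell_def shell_def)
  qed
  have fin': "emeasure \<mu> (cell U e k c) < \<infinity>" if "c \<in> ?K" for c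
    using emeasure_mono[OF sub[OF that], of \<mu>] fin U(2) \<mu> by (auto simp: Times_borel intro: le_less_trans)
  have sets: "cell U e k c \<in> sets \<mu>" for c using cell_sets[OF U(2)] \<mu> by simp
  have "(\<Sum>c\<in>?K. w (snd (snd c)) * measure \<mu> (cell U e k c))
      = (\<Sum>c\<in>?K. \<integral>p. w (snd (snd c)) * indicator (cell U e k c) p \<partial>\<mu>)"
    using sets by (simp add: sets.Int_space_eq2)
  also have "\<dots> = (\<integral>p. (\<Sum>c\<in>?K. w (snd (snd c)) * indicator (cell U e k c) p) \<partial>\<mu>)"
    using fin' sets by (intro Bochner_Integration.integral_sum[symmetric] integrable_mult_right integrable_real_indicator) auto
  finally show ?thesis unfolding cell_indicator_sum[OF U(1) e] .
qed

lemma nn_integral_intensity_product: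
  assumes [measurable]: "U \<in> sets borel" "f \<in> borel_measurable borel"
  shows "(\<integral>\<^sup>+p. indicator U (fst p) * f (snd p) \<partial>intensity l) = emeasure lborel U * (\<integral>\<^sup>+y. f y \<partial>l)"
proof -
  interpret sigma_finite_measure l by (rule sigma_finite_l)
  have "(\<integral>\<^sup>+p. indicator U (fst p) * f (snd p) \<partial>intensity l)
      = (\<integral>\<^sup>+z. \<integral>\<^sup>+y. indicator U (fst (z, y)) * f (snd (z, y)) \<partial>l \<partial>lborel)"
    unfolding intensity_def by (rule nn_integral_fst[symmetric]) measurable
  also have "\<dots> = (\<integral>\<^sup>+z. indicator U z * (\<integral>\<^sup>+y. f y \<partial>l) \<partial>lborel)"
    by (simp add: nn_integral_cmult)
  also have "\<dots> = emeasure lborel U * (\<integral>\<^sup>+y. f y \<partial>l)" by (simp add: nn_integral_multc)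
  finally show ?thesis .
qed

text \<open>The mesh \<open>1/k\<close> is at most the inner radius \<open>u\<close>, hence less
  than \<open>\<bar>y\<bar>\<close> on the shell. Rounding therefore at most doubles the jump size,
  and the second moment grows by a factor of at most 4.\<close>

lemma discretised_variance_le:
  assumes U: "U \<in> sets borel" "emeasure lborel U < \<infinity>" and u: "0 < u" "1 \<le> real k * u" and v: "v \<le> 1"
  shows "(\<integral>p. indicator (U \<times> shell u v) p * (\<lfloor>real k * snd p\<rfloor> / real k)\<^sup>2 \<partial>intensity l)
    \<le> 4 * (measure lborel U * small_var v)"
proof (rule integral_real_bounded)
  have k: "0 < k" using u by (cases k) auto
  have bd: "indicator (U \<times> shell u v) p * (\<lfloor>real k * snd p\<rfloor> / real k)\<^sup>2
      \<le> indicator U (fst p) * (4 * (indicator {y. \<bar>y\<bar> \<le> v} (snd p) * (snd p)\<^sup>2))" for p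
  proof (cases "p \<in> U \<times> shell u v")
    case True
    then have y: "u < \<bar>snd p\<bar>" "\<bar>snd p\<bar> \<le> v" "fst p \<in> U" by (auto simp: shell_def)
    have "1 / real k \<le> u" using u k by (simp add: field_simps)
    then have "\<bar>\<lfloor>real k * snd p\<rfloor> / real k\<bar> \<le> \<bar>2 * snd p\<bar>" using floor_approx[OF k, of "snd p"] y by linarith
    then have "(\<lfloor>real k * snd p\<rfloor> / real k)\<^sup>2 \<le> (2 * snd p)\<^sup>2" by (simp only: abs_le_square_iff)
    then show ?thesis using y True by (simp add: power_mult_distrib)
  qed auto
  have "(\<integral>\<^sup>+p. ennreal (indicator (U \<times> shell u v) p * (\<lfloor>real k * snd p\<rfloor> / real k)\<^sup>2) \<partial>intensity l)
     \<le> (\<integral>\<^sup>+p. indicator U (fst p) * ennreal (4 * (indicator {y. \<bar>y\<bar> \<le> v} (snd p) * (snd p)\<^sup>2)) \<partial>intensity l)"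
  proof (intro nn_integral_mono)
    fix p :: "(real \<times> real) \<times> real"
    have "ennreal (indicator (U \<times> shell u v) p * (\<lfloor>real k * snd p\<rfloor> / real k)\<^sup>2)
        \<le> ennreal (indicator U (fst p) * (4 * (indicator {y. \<bar>y\<bar> \<le> v} (snd p) * (snd p)\<^sup>2)))"
      by (rule ennreal_leI[OF bd])
    also have "\<dots> = indicator U (fst p) * ennreal (4 * (indicator {y. \<bar>y\<bar> \<le> v} (snd p) * (snd p)\<^sup>2))"
      by (simp add: indicator_def)
    finally show "ennreal (indicator (U \<times> shell u v) p * (\<lfloor>real k * snd p\<rfloor> / real k)\<^sup>2)
        \<le> indicator U (fst p) * ennreal (4 * (indicator {y. \<bar>y\<bar> \<le> v} (snd p) * (snd p)\<^sup>2))" .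
  qed
  also have "\<dots> = emeasure lborel U * (\<integral>\<^sup>+y. ennreal (4 * (indicator {y. \<bar>y\<bar> \<le> v} y * y\<^sup>2)) \<partial>l)"
    by (rule nn_integral_intensity_product[OF U(1)]) measurable
  also have "(\<integral>\<^sup>+y. ennreal (4 * (indicator {y. \<bar>y\<bar> \<le> v} y * y\<^sup>2)) \<partial>l) = ennreal (4 * small_var v)"
    unfolding small_var_def
    using nn_integral_eq_integral[OF integrable_mult_right[OF small_var_integrable[OF v], of 4]] by simp
  also have "emeasure lborel U = ennreal (measure lborel U)" using U by (intro emeasure_eq_ennreal_measure) auto
  finally show "(\<integral>\<^sup>+p. ennreal (indicator (U \<times> shell u v) p * (\<lfloor>real k * snd p\<rfloor> / real k)\<^sup>2) \<partial>intensity l)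
     \<le> ennreal (4 * (measure lborel U * small_var v))"
    using small_var_nonneg[of v] by (simp flip: ennreal_mult add: ac_simps)
qed (use small_var_nonneg in simp)

lemma discretised_maximal_inequality:
  fixes U :: "nat \<Rightarrow> (real \<times> real) set"
  assumes U: "mono U" "\<And>i. U i \<in> sets borel" "\<And>i. emeasure lborel (U i) < \<infinity>"
    and e: "decseq e" "e 0 \<le> 1" "\<And>n. 0 < e n" and k: "1 \<le> real k * e B" and L: "0 < L"
  shows "prob {\<omega> \<in> space M. \<exists>b\<le>B. \<exists>a\<le>A. 4 * L <
      \<bar>compensated (\<lambda>p. indicator (U a \<times> shell (e b) (e 0)) p * (\<lfloor>real k * snd p\<rfloor> / real k)) \<omega>\<bar>}
    \<le> 16 * (measure lborel (U A) * small_var (e 0)) / L\<^sup>2"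
proof -
  define K where "K = {..A} \<times> {..<B} \<times> {- int k..int k}"
  \<comment> \<open>\<open>W c\<close> is the contribution of one cell to the rounded compensated
    integral. Disjoint cells make these variables independent, and the variance of
    \<open>W c\<close> is \<open>(q/k)\<^sup>2\<close> times the intensity of the cell.\<close>
  define W where "W c \<omega> = (real_of_int (snd (snd c)) / real k) * (measure (N \<omega>) (cell U e k c) - measure (intensity l) (cell U e k c))" for c \<omega>
  have fin: "emeasure (intensity l) (U a \<times> shell (e b) (e 0)) < \<infinity>" for a b
    by (rule emeasure_strip_finite[OF U(2,3) e(3)[of b]]) (auto simp: shell_def)
  have cellm: "cell U e k c \<in> sets borel" for c by (rule cell_sets[OF U(2)])
  have cellfin: "emeasure (intensity l) (cell U e k c) < \<infinity>" for c
  proof -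
    obtain i n q where c: "c = (i, n, q)" by (cases c)
    have "e n \<le> e 0" using e(1) by (simp add: decseq_def)
    then have "cell U e k c \<subseteq> U i \<times> shell (e (Suc n)) (e 0)"
      using disjointed_subset[of U i] by (auto simp: c cell_def shell_def)
    then have "emeasure (intensity l) (cell U e k c) \<le> emeasure (intensity l) (U i \<times> shell (e (Suc n)) (e 0))"
      using U(2) by (intro emeasure_mono) (simp_all add: Times_borel)
    then show ?thesis using fin[of i "Suc n"] by (rule le_less_trans)
  qed
  have ind: "indep_vars (\<lambda>_. borel) W K"
    unfolding W_def[abs_def] measure_def
    by (rule indep_vars_compose2[where Y="\<lambda>c x. (real_of_int (snd (snd c)) / real k) * (enn2real x - enn2real (emeasure (intensity l) (cell U e k c)))",
          OF N_indep[OF _ cell_disjoint[OF U(1) e(1)] cellm]]) (auto simp: K_def)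
  have sq: "integrable M (\<lambda>\<omega>. (W c \<omega>)\<^sup>2)" for c
    unfolding W_def power_mult_distrib by (intro integrable_mult_right N_compensated_moments cellm cellfin)
  have cent: "expectation (W c) = 0" for c
    unfolding W_def using N_compensated_moments(3)[OF cellm cellfin] by simp
  have "(\<Sum>c\<in>K. expectation (\<lambda>\<omega>. (W c \<omega>)\<^sup>2))
      = (\<Sum>c\<in>K. (real_of_int (snd (snd c)) / real k)\<^sup>2 * measure (intensity l) (cell U e k c))"
    unfolding W_def power_mult_distrib using N_compensated_moments(2)[OF cellm cellfin] by simp
  also have "\<dots> = (\<integral>p. indicator (U A \<times> shell (e B) (e 0)) p * (\<lfloor>real k * snd p\<rfloor> / real k)\<^sup>2 \<partial>intensity l)"
    unfolding K_def using cell_sum_integral[OF U(1,2) e(1,2) sets_intensity fin, where w="\<lambda>q. (q / real k)\<^sup>2"] by simp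
  also have "\<dots> \<le> 4 * (measure lborel (U A) * small_var (e 0))"
    by (rule discretised_variance_le[OF U(2,3) e(3) k e(2)])
  finally have V: "(\<Sum>c\<in>K. expectation (\<lambda>\<omega>. (W c \<omega>)\<^sup>2)) \<le> 4 * (measure lborel (U A) * small_var (e 0))" .
  \<comment> \<open>The set \<open>U a\<close> consists of the increments with index at most
    \<open>a\<close>, while the partial sums are over indices strictly below their bound; hence
    \<open>Suc A\<close>. Shell indices are already strict.\<close>
  have max: "prob {\<omega> \<in> space M. \<exists>b\<le>B. \<exists>a\<le>Suc A. 4 * L < \<bar>\<Sum>c\<in>{c \<in> K. fst c < a \<and> fst (snd c) < b}. W c \<omega>\<bar>}
     \<le> 4 * (4 * (measure lborel (U A) * small_var (e 0))) / L\<^sup>2"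
    by (rule two_parameter_maximal_inequality[OF _ ind sq cent V L]) (simp add: K_def)
  have Wm [measurable]: "W c \<in> borel_measurable M" if "c \<in> K" for c using ind that by (auto simp: indep_vars_def)
  \<comment> \<open>The identity between sum of cells and integral holds for those realisations
    whose mass on each of these finitely many strips is finite.\<close>
  have "AE \<omega> in M. \<forall>b\<in>{..B}. \<forall>a\<in>{..A}. emeasure (N \<omega>) (U a \<times> shell (e b) (e 0)) < \<infinity>"
    using fin U(2) by (intro AE_finite_allI N_finite) (auto intro: Times_borel)
  then have "AE \<omega> in M. (\<exists>b\<le>B. \<exists>a\<le>A. 4 * L <
        \<bar>compensated (\<lambda>p. indicator (U a \<times> shell (e b) (e 0)) p * (\<lfloor>real k * snd p\<rfloor> / real k)) \<omega>\<bar>) \<longrightarrow>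
      (\<exists>b\<le>B. \<exists>a\<le>Suc A. 4 * L < \<bar>\<Sum>c\<in>{c \<in> K. fst c < a \<and> fst (snd c) < b}. W c \<omega>\<bar>)"
    using AE_space
  proof eventually_elim
    case (elim \<omega>)
    show ?case
    proof (intro impI, elim exE conjE)
      fix a b assume ab: "b \<le> B" "a \<le> A"
        and gt: "4 * L < \<bar>compensated (\<lambda>p. indicator (U a \<times> shell (e b) (e 0)) p * (\<lfloor>real k * snd p\<rfloor> / real k)) \<omega>\<bar>"
      have sN: "sets (N \<omega>) = sets borel" using elim(2) by simp
      have fN: "emeasure (N \<omega>) (U a \<times> shell (e b) (e 0)) < \<infinity>" using elim(1) ab by simp
      have "{c \<in> K. fst c < Suc a \<and> fst (snd c) < b} = {..a} \<times> {..<b} \<times> {- int k..int k}"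
        using ab by (auto simp: K_def)
      then have "(\<Sum>c\<in>{c \<in> K. fst c < Suc a \<and> fst (snd c) < b}. W c \<omega>)
         = (\<Sum>c\<in>{..a} \<times> {..<b} \<times> {- int k..int k}. (real_of_int (snd (snd c)) / real k) * measure (N \<omega>) (cell U e k c))
         - (\<Sum>c\<in>{..a} \<times> {..<b} \<times> {- int k..int k}. (real_of_int (snd (snd c)) / real k) * measure (intensity l) (cell U e k c))"
        by (simp add: W_def right_diff_distrib sum_subtractf)
      also have "\<dots> = compensated (\<lambda>p. indicator (U a \<times> shell (e b) (e 0)) p * (\<lfloor>real k * snd p\<rfloor> / real k)) \<omega>"
        unfolding compensated_def
        using cell_sum_integral[OF U(1,2) e(1,2) sets_intensity fin, where w="\<lambda>q. q / real k"]
          cell_sum_integral[OF U(1,2) e(1,2) sN fN, where w="\<lambda>q. q / real k"]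
        by simp
      finally have "4 * L < \<bar>\<Sum>c\<in>{c \<in> K. fst c < Suc a \<and> fst (snd c) < b}. W c \<omega>\<bar>" using gt by simp
      then show "\<exists>b\<le>B. \<exists>a\<le>Suc A. 4 * L < \<bar>\<Sum>c\<in>{c \<in> K. fst c < a \<and> fst (snd c) < b}. W c \<omega>\<bar>"
        using ab by (intro exI[of _ b] conjI exI[of _ "Suc a"]) auto
    qed
  qed
  then have "prob {\<omega> \<in> space M. \<exists>b\<le>B. \<exists>a\<le>A. 4 * L <
        \<bar>compensated (\<lambda>p. indicator (U a \<times> shell (e b) (e 0)) p * (\<lfloor>real k * snd p\<rfloor> / real k)) \<omega>\<bar>}
      \<le> prob {\<omega> \<in> space M. \<exists>b\<le>B. \<exists>a\<le>Suc A. 4 * L < \<bar>\<Sum>c\<in>{c \<in> K. fst c < a \<and> fst (snd c) < b}. W c \<omega>\<bar>}"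
    (is "prob ?E \<le> prob ?F")
  proof (intro finite_measure_mono_AE)
    assume "AE \<omega> in M. (\<exists>b\<le>B. \<exists>a\<le>A. 4 * L <
        \<bar>compensated (\<lambda>p. indicator (U a \<times> shell (e b) (e 0)) p * (\<lfloor>real k * snd p\<rfloor> / real k)) \<omega>\<bar>) \<longrightarrow>
      (\<exists>b\<le>B. \<exists>a\<le>Suc A. 4 * L < \<bar>\<Sum>c\<in>{c \<in> K. fst c < a \<and> fst (snd c) < b}. W c \<omega>\<bar>)"
    then show "AE \<omega> in M. \<omega> \<in> ?E \<longrightarrow> \<omega> \<in> ?F" by eventually_elim simp
  qed measurable
  then show ?thesis using max by simp
qed

end

section \<open>Compensated integrals over increasing families\<close>

text \<open>The intersection of all events is no more likely than any single one. Avoiding one event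
  is enough later, because the event attached to a level controls all subsequent levels; no summable
  rate enters.\<close>

lemma (in prob_space) AE_ex_notin_of_prob_tendsto_0:
  assumes E: "\<And>n::nat. E n \<in> events" and lim: "(\<lambda>n. prob (E n)) \<longlonglongrightarrow> 0"
  shows "AE x in M. \<exists>n. x \<notin> E n"
proof -
  have m: "(\<Inter>n. E n) \<in> events" using E by auto
  have "prob (\<Inter>n. E n) \<le> prob (E n)" for n using E by (intro finite_measure_mono) auto
  then have "prob (\<Inter>n. E n) \<le> 0" using lim by (intro LIMSEQ_le_const) auto
  then have "prob (\<Inter>n. E n) = 0" using measure_nonneg[of M "\<Inter>n. E n"] by linarith
  then have "(\<Inter>n. E n) \<in> null_sets M" using m by (simp add: null_sets_def emeasure_eq_measure)
  then have "AE x in M. x \<notin> (\<Inter>n. E n)" by (rule AE_not_in)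
  then show ?thesis by eventually_elim auto
qed

definition dyadic :: "nat \<Rightarrow> nat \<Rightarrow> real" where
  "dyadic k i = real i / 2 ^ k"

lemma dyadic_refine: "k \<le> j \<Longrightarrow> dyadic j (i * 2 ^ (j - k)) = dyadic k i"
  by (auto simp: dyadic_def power_add dest!: le_Suc_ex)

context poisson_jumps begin

abbreviation jumps :: "(real \<times> real) set \<Rightarrow> real set \<Rightarrow> (real \<times> real) \<times> real \<Rightarrow> real" where
  "jumps B E \<equiv> \<lambda>p. indicator (B \<times> E) p * snd p"

lemma snd_borel [measurable]: "snd \<in> borel_measurable (borel :: ('x::second_countable_topology \<times> 'y::second_countable_topology) measure)"
  by (intro borel_measurable_continuous_onI continuous_intros)

text \<open>Rounding moves each jump size by at most \<open>1/k\<close>. The error of each of the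
  two integrals is thus at most \<open>1/k\<close> times the mass of the strip, which is finite
  under the realisation as well as under the intensity.\<close>

lemma discretisation_tendsto:
  assumes U: "U \<in> sets borel" "emeasure lborel U < \<infinity>" and u: "0 < u" and v: "v \<le> 1"
    and \<omega>: "\<omega> \<in> space M" "emeasure (N \<omega>) (U \<times> shell u v) < \<infinity>"
  shows "(\<lambda>k. compensated (\<lambda>p. indicator (U \<times> shell u v) p * (\<lfloor>real k * snd p\<rfloor> / real k)) \<omega>)
    \<longlonglongrightarrow> compensated (jumps U (shell u v)) \<omega>"
proof -
  let ?C = "U \<times> shell u v"
  have C: "?C \<in> sets borel" using U by (simp add: Times_borel)
  have fin: "emeasure (intensity l) ?C < \<infinity>"
    by (rule emeasure_strip_finite[OF U u]) (auto simp: shell_def)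
  have diff: "\<bar>(\<integral>p. indicator ?C p * (\<lfloor>real k * snd p\<rfloor> / real k) \<partial>\<mu>) - (\<integral>p. indicator ?C p * snd p \<partial>\<mu>)\<bar>
      \<le> 1 / real k * measure \<mu> ?C"
    if k: "0 < k" and \<mu>: "sets \<mu> = sets borel" "emeasure \<mu> ?C < \<infinity>" for k \<mu>
  proof (rule integral_diff_le_on[OF _ \<mu>(2)])
    have y: "\<bar>snd p\<bar> \<le> 1" if "p \<in> ?C" for p using that v by (auto simp: shell_def)
    have fl: "\<bar>\<lfloor>real k * snd p\<rfloor> / real k\<bar> \<le> 2" if "p \<in> ?C" for p
    proof -
      have "1 / real k \<le> 1" using k by simp
      then show ?thesis using floor_approx[OF k, of "snd p"] y[OF that] by linarith
    qed
    show "?C \<in> sets \<mu>" using C \<mu> by simp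
    then show "integrable \<mu> (\<lambda>p. indicator ?C p * (\<lfloor>real k * snd p\<rfloor> / real k))"
      using \<mu> fl by (intro bounded_integrable_on[where c=2]) (auto cong: measurable_cong_sets)
    show "integrable \<mu> (\<lambda>p. indicator ?C p * snd p)"
      using \<open>?C \<in> sets \<mu>\<close> \<mu> y by (intro bounded_integrable_on[where c=1]) (auto cong: measurable_cong_sets)
    show "\<bar>\<lfloor>real k * snd p\<rfloor> / real k - snd p\<bar> \<le> 1 / real k" for p :: "(real \<times> real) \<times> real"
      by (rule floor_approx[OF k])
  qed
  have "eventually (\<lambda>k. norm (compensated (\<lambda>p. indicator ?C p * (\<lfloor>real k * snd p\<rfloor> / real k)) \<omega> - compensated (jumps U (shell u v)) \<omega>)
      \<le> (measure (N \<omega>) ?C + measure (intensity l) ?C) * (1 / real k)) sequentially"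
    using eventually_gt_at_top[of 0]
  proof eventually_elim
    case (elim k)
    have n: "\<bar>(\<integral>p. indicator ?C p * (\<lfloor>real k * snd p\<rfloor> / real k) \<partial>N \<omega>) - (\<integral>p. indicator ?C p * snd p \<partial>N \<omega>)\<bar>
      \<le> 1 / real k * measure (N \<omega>) ?C" using \<omega> by (intro diff elim) auto
    have i: "\<bar>(\<integral>p. indicator ?C p * (\<lfloor>real k * snd p\<rfloor> / real k) \<partial>intensity l) - (\<integral>p. indicator ?C p * snd p \<partial>intensity l)\<bar>
      \<le> 1 / real k * measure (intensity l) ?C" using fin by (intro diff elim) auto
    have "(measure (N \<omega>) ?C + measure (intensity l) ?C) * (1 / real k) = 1 / real k * measure (N \<omega>) ?C + 1 / real k * measure (intensity l) ?C"
      by (simp add: add_divide_distrib)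
    then show ?case unfolding compensated_def real_norm_def using n i by linarith
  qed
  moreover have "(\<lambda>k. (measure (N \<omega>) ?C + measure (intensity l) ?C) * (1 / real k)) \<longlonglongrightarrow> 0"
    by (intro tendsto_mult_right_zero lim_1_over_n)
  ultimately have "(\<lambda>k. compensated (\<lambda>p. indicator ?C p * (\<lfloor>real k * snd p\<rfloor> / real k)) \<omega> - compensated (jumps U (shell u v)) \<omega>) \<longlonglongrightarrow> 0"
    by (rule Lim_null_comparison)
  then show ?thesis by (simp add: LIM_zero_iff)
qed

lemma jumps_borel [measurable]:
  assumes "B \<in> sets borel" "E \<in> sets borel" shows "jumps B E \<in> borel_measurable borel"
proof -
  note [measurable] = Times_borel[OF assms]
  show ?thesis by measurable
qed

lemma shell_maximal_inequality:
  fixes U :: "nat \<Rightarrow> (real \<times> real) set"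
  assumes U: "mono U" "\<And>i. U i \<in> sets borel" "\<And>i. emeasure lborel (U i) < \<infinity>"
    and e: "decseq e" "e 0 \<le> 1" "\<And>n. 0 < e n" and L: "0 < L"
  shows "prob {\<omega> \<in> space M. \<exists>b\<le>B. \<exists>a\<le>A. 4 * L < \<bar>compensated (jumps (U a) (shell (e b) (e 0))) \<omega>\<bar>}
    \<le> 16 * (measure lborel (U A) * small_var (e 0)) / L\<^sup>2"
proof (rule prob_le_of_eventually)
  define g where "g k a b = (\<lambda>p. indicator (U a \<times> shell (e b) (e 0)) p * (\<lfloor>real k * snd p\<rfloor> / real k))" for k a b
  have Tb [measurable]: "U a \<times> shell (e b) (e 0) \<in> sets borel" for a b using U(2) by (simp add: Times_borel)
  have [measurable]: "compensated (jumps (U a) (shell (e b) (e 0))) \<in> borel_measurable M" for a b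
    using U(2) by (intro compensated_measurable jumps_borel) auto
  have [measurable]: "compensated (g k a b) \<in> borel_measurable M" for k a b
    unfolding g_def by (rule compensated_measurable) measurable
  show "{\<omega> \<in> space M. \<exists>b\<le>B. \<exists>a\<le>A. 4 * L < \<bar>compensated (jumps (U a) (shell (e b) (e 0))) \<omega>\<bar>} \<in> events"
    by measurable
  show "{\<omega> \<in> space M. \<exists>b\<le>B. \<exists>a\<le>A. 4 * L < \<bar>compensated (g k a b) \<omega>\<bar>} \<in> events" for k
    by measurable
  \<comment> \<open>For large \<open>k\<close> the mesh falls below the innermost radius
    \<open>e B\<close>, as the bound for rounded jumps requires.\<close>
  have "filterlim (\<lambda>k. real k * e B) at_top sequentially"
    using filterlim_tendsto_pos_mult_at_top[OF tendsto_const e(3)[of B] filterlim_real_sequentially]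
    by (simp add: mult.commute)
  then have "eventually (\<lambda>k. 1 \<le> real k * e B) sequentially" by (simp add: filterlim_at_top)
  then show "eventually (\<lambda>k. prob {\<omega> \<in> space M. \<exists>b\<le>B. \<exists>a\<le>A. 4 * L < \<bar>compensated (g k a b) \<omega>\<bar>}
      \<le> 16 * (measure lborel (U A) * small_var (e 0)) / L\<^sup>2) sequentially"
    unfolding g_def by eventually_elim (rule discretised_maximal_inequality[OF U e _ L])
  have "AE \<omega> in M. \<forall>b\<in>{..B}. \<forall>a\<in>{..A}. emeasure (N \<omega>) (U a \<times> shell (e b) (e 0)) < \<infinity>"
  proof (intro AE_finite_allI N_finite Tb)
    show "emeasure (intensity l) (U a \<times> shell (e b) (e 0)) < \<infinity>" for a b
      by (rule emeasure_strip_finite[OF U(2,3) e(3)[of b]]) (auto simp: shell_def)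
  qed auto
  then show "AE \<omega> in M. \<omega> \<in> {\<omega> \<in> space M. \<exists>b\<le>B. \<exists>a\<le>A. 4 * L < \<bar>compensated (jumps (U a) (shell (e b) (e 0))) \<omega>\<bar>}
      \<longrightarrow> eventually (\<lambda>k. \<omega> \<in> {\<omega> \<in> space M. \<exists>b\<le>B. \<exists>a\<le>A. 4 * L < \<bar>compensated (g k a b) \<omega>\<bar>}) sequentially"
  proof eventually_elim
    case (elim \<omega>)
    show ?case
    proof
      assume "\<omega> \<in> {\<omega> \<in> space M. \<exists>b\<le>B. \<exists>a\<le>A. 4 * L < \<bar>compensated (jumps (U a) (shell (e b) (e 0))) \<omega>\<bar>}"
      then obtain a b where ab: "\<omega> \<in> space M" "b \<le> B" "a \<le> A"
        and gt: "4 * L < \<bar>compensated (jumps (U a) (shell (e b) (e 0))) \<omega>\<bar>" by auto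
      have "(\<lambda>k. \<bar>compensated (g k a b) \<omega>\<bar>) \<longlonglongrightarrow> \<bar>compensated (jumps (U a) (shell (e b) (e 0))) \<omega>\<bar>"
        unfolding g_def using elim ab by (intro tendsto_rabs discretisation_tendsto U e) auto
      \<comment> \<open>The strict inequality in the event is what lets it pass to all sufficiently
        fine approximations.\<close>
      then have "eventually (\<lambda>k. 4 * L < \<bar>compensated (g k a b) \<omega>\<bar>) sequentially"
        using gt by (rule order_tendstoD(1))
      then show "eventually (\<lambda>k. \<omega> \<in> {\<omega> \<in> space M. \<exists>b\<le>B. \<exists>a\<le>A. 4 * L < \<bar>compensated (g k a b) \<omega>\<bar>}) sequentially"
        by eventually_elim (use ab in auto)
    qed
  qed
qed

text \<open>The level \<open>n0\<close> fixes the outer radius of every shell. Outside this event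
  all later truncations are controlled relative to level \<open>n0\<close>, at all dyadic times up
  to \<open>T\<close> simultaneously. The horizon is a natural number so that each dyadic grid ends
  exactly at \<open>T\<close>.\<close>

definition large_deviation :: "(real \<Rightarrow> (real \<times> real) set) \<Rightarrow> (nat \<Rightarrow> real) \<Rightarrow> real \<Rightarrow> nat \<Rightarrow> nat \<Rightarrow> 'w set" where
  "large_deviation B \<epsilon> L T n0 = {\<omega> \<in> space M. \<exists>n\<ge>n0. \<exists>k i. i \<le> T * 2 ^ k \<and>
     4 * L < \<bar>compensated (jumps (B (dyadic k i)) (shell (\<epsilon> n) (\<epsilon> n0))) \<omega>\<bar>}"

lemma large_deviation_measurable:
  assumes "\<And>t. 0 \<le> t \<Longrightarrow> B t \<in> sets borel"
  shows "large_deviation B \<epsilon> L T n0 \<in> events"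
proof -
  have [measurable]: "compensated (jumps (B (dyadic k i)) (shell (\<epsilon> n) (\<epsilon> n0))) \<in> borel_measurable M" for k i n
    using assms by (intro compensated_measurable jumps_borel) (auto simp: dyadic_def)
  show ?thesis unfolding large_deviation_def by measurable
qed

text \<open>The maximal inequality on a finite grid gives a bound that depends only on the final set
  \<open>B T\<close> and the outermost radius, not on the fineness of the grid or the number of
  levels. It therefore survives the limit to all dyadic times and all levels.\<close>

lemma large_deviation_tendsto_0:
  assumes B: "mono_on {0..} B" "\<And>t. 0 \<le> t \<Longrightarrow> B t \<in> sets borel" "\<And>t. 0 \<le> t \<Longrightarrow> emeasure lborel (B t) < \<infinity>"
    and \<epsilon>: "decseq \<epsilon>" "\<epsilon> \<longlonglongrightarrow> 0" "\<And>n. 0 < \<epsilon> n \<and> \<epsilon> n < 1" and L: "0 < L"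
  shows "(\<lambda>n. prob (large_deviation B \<epsilon> L T n)) \<longlonglongrightarrow> 0"
proof (rule tendsto_sandwich[where f="\<lambda>_. 0" and h="\<lambda>n. 16 * (measure lborel (B (real T)) * small_var (\<epsilon> n)) / L\<^sup>2"])
  have d0: "0 \<le> dyadic k i" for k i by (simp add: dyadic_def)
  let ?c = "\<lambda>n0. 16 * (measure lborel (B (real T)) * small_var (\<epsilon> n0)) / L\<^sup>2"
  have "prob (large_deviation B \<epsilon> L T n0) \<le> ?c n0" for n0
  proof (rule prob_le_of_eventually)
    \<comment> \<open>A single parameter \<open>K\<close> refines the time grid and admits more
      levels. The form \<open>n0 + 0\<close> is the outer radius seen as entry 0 of the shifted
      sequence of levels.\<close>
    define A where "A K = {\<omega> \<in> space M. \<exists>b\<le>K. \<exists>a\<le>T * 2 ^ K. 4 * L <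
      \<bar>compensated (jumps (B (dyadic K a)) (shell (\<epsilon> (n0 + b)) (\<epsilon> (n0 + 0)))) \<omega>\<bar>}" for K
    show "large_deviation B \<epsilon> L T n0 \<in> events" by (rule large_deviation_measurable[OF B(2)])
    have [measurable]: "compensated (jumps (B (dyadic k i)) (shell (\<epsilon> n) (\<epsilon> m))) \<in> borel_measurable M" for k i n m
      using B(2) d0 by (intro compensated_measurable jumps_borel) auto
    show "A K \<in> events" for K unfolding A_def by measurable
    have "prob (A K) \<le> ?c n0" for K
    proof -
      have m: "mono (\<lambda>i. B (dyadic K i))"
        using B(1) by (intro monoI) (auto simp: mono_on_def dyadic_def divide_right_mono)
      have "dyadic K (T * 2 ^ K) = real T" by (simp add: dyadic_def)
      then show ?thesis
        using shell_maximal_inequality[of "\<lambda>i. B (dyadic K i)" "\<lambda>b. \<epsilon> (n0 + b)" L K "T * 2 ^ K"] m B(2,3) d0 \<epsilon>(1,3) L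
        unfolding A_def by (simp add: less_imp_le decseq_def)
    qed
    then show "eventually (\<lambda>K. prob (A K) \<le> ?c n0) sequentially" by simp
    show "AE \<omega> in M. \<omega> \<in> large_deviation B \<epsilon> L T n0 \<longrightarrow> eventually (\<lambda>K. \<omega> \<in> A K) sequentially"
    proof (rule AE_I2, rule impI)
      fix \<omega> assume "\<omega> \<in> large_deviation B \<epsilon> L T n0"
      then obtain n k i where \<omega>: "\<omega> \<in> space M" "n0 \<le> n" "i \<le> T * 2 ^ k"
        and gt: "4 * L < \<bar>compensated (jumps (B (dyadic k i)) (shell (\<epsilon> n) (\<epsilon> n0))) \<omega>\<bar>"
        by (auto simp: large_deviation_def)
      show "eventually (\<lambda>K. \<omega> \<in> A K) sequentially"
        using eventually_ge_at_top[of "max (n - n0) k"]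
      proof eventually_elim
        case (elim K)
        then have K: "n - n0 \<le> K" "k \<le> K" by auto
        have "i * 2 ^ (K - k) \<le> T * 2 ^ k * 2 ^ (K - k)" using \<omega> by (intro mult_right_mono) auto
        also have "\<dots> = T * 2 ^ K" using K by (simp flip: power_add)
        finally have "i * 2 ^ (K - k) \<le> T * 2 ^ K" .
        then show "\<omega> \<in> A K" unfolding A_def
          using \<omega> K gt dyadic_refine[OF K(2), of i]
          by (intro CollectI conjI exI[of _ "n - n0"] exI[of _ "i * 2 ^ (K - k)"]) auto
      qed
    qed
  qed
  then show "eventually (\<lambda>n. prob (large_deviation B \<epsilon> L T n) \<le> ?c n) sequentially" by simp
  have "(\<lambda>n. small_var (\<epsilon> n)) \<longlonglongrightarrow> 0" using \<epsilon>(2,3) by (intro small_var_tendsto) (auto simp: less_imp_le)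
  then have "(\<lambda>n. 16 * (measure lborel (B (real T)) * small_var (\<epsilon> n)) / L\<^sup>2) \<longlonglongrightarrow> 16 * (measure lborel (B (real T)) * 0) / L\<^sup>2"
    using L by (intro tendsto_intros) auto
  then show "?c \<longlonglongrightarrow> 0" by simp
qed auto

end

section \<open>Convergence\<close>

lemma abs_le_of_dyadic:
  fixes f :: "real \<Rightarrow> real"
  assumes t: "0 \<le> t" "t < T" and f: "(f \<longlongrightarrow> f t) (at_right t)"
    and le: "\<And>k i. i \<le> nat \<lceil>T\<rceil> * 2 ^ k \<Longrightarrow> \<bar>f (dyadic k i)\<bar> \<le> c"
  shows "\<bar>f t\<bar> \<le> c"
proof -
  \<comment> \<open>Adding 1 puts the approximating dyadic strictly to the right of
    \<open>t\<close>, as the filter \<open>at_right t\<close> requires; the gap between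
    \<open>t\<close> and \<open>T\<close> keeps it in range for large \<open>k\<close>.\<close>
  define i where "i k = nat \<lfloor>t * 2 ^ k\<rfloor> + 1" for k
  have lower: "t < dyadic k (i k)" and upper: "dyadic k (i k) \<le> t + 1 / 2 ^ k" for k
  proof -
    have p: "(0::real) < 2 ^ k" by simp
    have "0 \<le> t * 2 ^ k" using t by simp
    then have "real (i k) = of_int \<lfloor>t * 2 ^ k\<rfloor> + 1" by (simp add: i_def)
    then have "t * 2 ^ k < real (i k)" "real (i k) \<le> t * 2 ^ k + 1" by linarith+
    then show "t < dyadic k (i k)" "dyadic k (i k) \<le> t + 1 / 2 ^ k"
      using p by (simp_all add: dyadic_def field_simps)
  qed
  have "(\<lambda>k. t + 1 / 2 ^ k) \<longlonglongrightarrow> t + 0"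
    using LIMSEQ_divide_realpow_zero[of 2 1] by (intro tendsto_intros) auto
  then have up: "(\<lambda>k. t + 1 / 2 ^ k) \<longlonglongrightarrow> t" by simp
  have lim: "(\<lambda>k. dyadic k (i k)) \<longlonglongrightarrow> t"
    by (rule tendsto_sandwich[OF _ _ tendsto_const up]) (use lower upper in \<open>simp_all add: less_imp_le\<close>)
  then have "filterlim (\<lambda>k. dyadic k (i k)) (at_right t) sequentially"
    using lower by (intro tendsto_imp_filterlim_at_right) auto
  then have "(\<lambda>k. \<bar>f (dyadic k (i k))\<bar>) \<longlonglongrightarrow> \<bar>f t\<bar>"
    by (intro tendsto_rabs filterlim_compose[OF f])
  moreover have "eventually (\<lambda>k. \<bar>f (dyadic k (i k))\<bar> \<le> c) sequentially"
  proof -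
    have "eventually (\<lambda>k. dyadic k (i k) < T) sequentially" using lim t(2) by (rule order_tendstoD(2))
    then show ?thesis
    proof eventually_elim
      case (elim k)
      have "T \<le> real (nat \<lceil>T\<rceil>)" by linarith
      then have "real (i k) / 2 ^ k \<le> real (nat \<lceil>T\<rceil>)" using elim by (simp add: dyadic_def)
      then have "real (i k) \<le> real (nat \<lceil>T\<rceil> * 2 ^ k)" by (simp add: divide_le_eq)
      then have "i k \<le> nat \<lceil>T\<rceil> * 2 ^ k" by (simp only: of_nat_le_iff)
      then show ?case by (rule le)
    qed
  qed
  ultimately show ?thesis by (rule tendsto_upperbound) simp
qed

lemma small_jumps_split:
  assumes "0 < u" "u \<le> v" "v < 1"
  shows "indicator (small_jumps u) y = (indicator (small_jumps v) y + indicator (shell u v) y :: real)"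
  using assms by (auto simp: small_jumps_def shell_def indicator_def)

lemma small_jumps_borel [measurable, simp]: "small_jumps u \<in> sets borel"
  unfolding small_jumps_def by measurable

section \<open>Geometry of the moving ambit set\<close>

locale ambit =
  fixes \<phi> :: "real \<Rightarrow> real"
  assumes cont: "continuous_on {..0} \<phi>" and mon: "mono_on {..0} \<phi>" and nonneg: "\<forall>s\<le>0. 0 \<le> \<phi> s"
    and int: "set_integrable lborel {..0} \<phi>"
begin

abbreviation ambit_at :: "real \<Rightarrow> (real \<times> real) set" where
  "ambit_at t \<equiv> shift_set (ambit_set \<phi>) t"

text \<open>For \<open>t \<ge> 0\<close> this is the union of \<open>ambit_at r\<close> over
  \<open>0 \<le> r \<le> t\<close>. To the left of time 0 monotonicity of \<open>\<phi>\<close>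
  makes the initial set the largest; to the right, continuity at 0 fills the whole height
  \<open>\<phi> 0\<close>.\<close>

definition entered :: "real \<Rightarrow> (real \<times> real) set" where
  "entered t = ambit_set \<phi> \<union> {0..<t} \<times> {0<..<\<phi> 0}"

definition departed :: "real \<Rightarrow> (real \<times> real) set" where
  "departed t = entered t - ambit_at t"

lemma ambit_at_iff: "(s, x) \<in> ambit_at t \<longleftrightarrow> s < t \<and> 0 < x \<and> x < \<phi> (s - t)"
proof
  assume "s < t \<and> 0 < x \<and> x < \<phi> (s - t)"
  then have "(s - t, x) \<in> ambit_set \<phi>" by (simp add: ambit_set_def)
  then show "(s, x) \<in> ambit_at t" unfolding shift_set_def by (rule rev_image_eqI) simp
qed (auto simp: shift_set_def ambit_set_def)

lemma mono_entered: "mono_on {0..} entered"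
  by (auto simp: mono_on_def entered_def)

text \<open>A point that has left never returns: at fixed \<open>s\<close> the height
  \<open>\<phi> (s - t)\<close> of the set decreases as \<open>t\<close> grows.\<close>

lemma mono_departed: "mono_on {0..} departed"
proof (intro mono_onI subsetI)
  fix t t' :: real and p assume t: "t \<in> {0..}" "t' \<in> {0..}" "t \<le> t'" and p: "p \<in> departed t"
  obtain s x where sx: "p = (s, x)" by (cases p)
  have e: "(s, x) \<in> entered t" and n: "(s, x) \<notin> ambit_at t" using p sx by (auto simp: departed_def)
  have "s < t" using e t by (auto simp: entered_def ambit_set_def)
  then have "\<phi> (s - t') \<le> \<phi> (s - t)" using t by (intro mono_onD[OF mon]) auto
  then have "(s, x) \<notin> ambit_at t'" using n \<open>s < t\<close> unfolding ambit_at_iff by auto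
  moreover have "(s, x) \<in> entered t'" using mono_onD[OF mono_entered t] e by blast
  ultimately show "p \<in> departed t'" by (simp add: sx departed_def)
qed

lemma ambit_at_subset_entered:
  assumes "0 \<le> t" shows "ambit_at t \<subseteq> entered t"
proof
  fix p assume p: "p \<in> ambit_at t"
  obtain s x where sx: "p = (s, x)" by (cases p)
  have s: "s < t" "0 < x" "x < \<phi> (s - t)" using p unfolding sx ambit_at_iff by auto
  show "p \<in> entered t"
  proof (cases "s < 0")
    case True
    then have "\<phi> (s - t) \<le> \<phi> s" using assms by (intro mono_onD[OF mon]) auto
    then show ?thesis using s True by (auto simp: sx entered_def ambit_set_def)
  next
    case False
    have "\<phi> (s - t) \<le> \<phi> 0" using s by (intro mono_onD[OF mon]) auto
    then show ?thesis using s False by (auto simp: sx entered_def)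
  qed
qed

lemma ambit_at_0: "ambit_at 0 = ambit_set \<phi>"
proof -
  have "(s, x) \<in> ambit_at 0 \<longleftrightarrow> (s, x) \<in> ambit_set \<phi>" for s x
    unfolding ambit_at_iff by (auto simp: ambit_set_def)
  then show ?thesis by auto
qed

lemma ambit_at_borel: "ambit_at t \<in> sets borel"
proof -
  \<comment> \<open>Continuity of \<open>\<phi>\<close> is known on the nonpositive half-line only;
    the minimum with 0 extends it continuously without changing the set.\<close>
  have c: "continuous_on UNIV (\<lambda>p :: real \<times> real. \<phi> (min (fst p - t) 0))"
    by (rule continuous_on_compose2[OF cont]) (auto intro!: continuous_intros)
  have "ambit_at t = {p. fst p < t} \<inter> {p. 0 < snd p} \<inter> {p. snd p < \<phi> (min (fst p - t) 0)}"
  proof (intro set_eqI)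
    fix p :: "real \<times> real"
    show "p \<in> ambit_at t \<longleftrightarrow> p \<in> {p. fst p < t} \<inter> {p. 0 < snd p} \<inter> {p. snd p < \<phi> (min (fst p - t) 0)}"
      by (cases p) (auto simp: ambit_at_iff min_def)
  qed
  also have "open \<dots>"
    by (intro open_Int open_Collect_less continuous_intros c)
  finally show ?thesis by simp
qed

lemma entered_borel: "entered t \<in> sets borel"
proof -
  have "{0..<t} \<times> {0<..<\<phi> 0} \<in> sets (borel :: (real \<times> real) measure)"
    using pair_measureI[of "{0..<t}" borel "{0<..<\<phi> 0}" borel] unfolding borel_prod by simp
  then show ?thesis using ambit_at_borel[of 0] unfolding entered_def ambit_at_0 by simp
qed

lemma departed_borel: "departed t \<in> sets borel"
  unfolding departed_def using entered_borel ambit_at_borel by auto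

lemma ambit_finite: "emeasure lborel (ambit_set \<phi>) < \<infinity>"
proof -
  have "ambit_set \<phi> \<in> sets (lborel \<Otimes>\<^sub>M lborel :: (real \<times> real) measure)"
    using ambit_at_borel[of 0] unfolding ambit_at_0 lborel_prod by simp
  then have "emeasure (lborel \<Otimes>\<^sub>M lborel) (ambit_set \<phi>) = (\<integral>\<^sup>+s. emeasure lborel (Pair s -` ambit_set \<phi>) \<partial>lborel)"
    by (rule lborel.emeasure_pair_measure_alt)
  also have "\<dots> \<le> (\<integral>\<^sup>+s. ennreal (norm (indicator {..0} s *\<^sub>R \<phi> s)) \<partial>lborel)"
  proof (intro nn_integral_mono)
    fix s :: real
    show "emeasure lborel (Pair s -` ambit_set \<phi>) \<le> ennreal (norm (indicator {..0} s *\<^sub>R \<phi> s))"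
    proof (cases "s < 0")
      case True
      then have "Pair s -` ambit_set \<phi> = {0<..<\<phi> s}" by (auto simp: ambit_set_def)
      then show ?thesis using True nonneg by simp
    next
      case False
      then have "Pair s -` ambit_set \<phi> = {}" by (auto simp: ambit_set_def)
      then show ?thesis by simp
    qed
  qed
  also have "\<dots> < \<infinity>" using int unfolding set_integrable_def integrable_iff_bounded by simp
  finally show ?thesis unfolding lborel_prod .
qed

lemma entered_finite: "emeasure lborel (entered t) < \<infinity>"
proof -
  have "bounded ({0..<t} \<times> {0<..<\<phi> 0})" by (intro bounded_Times) auto
  then have "emeasure lborel ({0..<t} \<times> {0<..<\<phi> 0}) < \<infinity>" by (rule emeasure_bounded_finite)
  moreover have "{0..<t} \<times> {0<..<\<phi> 0} \<in> sets (borel :: (real \<times> real) measure)"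
    using pair_measureI[of "{0..<t}" borel "{0<..<\<phi> 0}" borel] unfolding borel_prod by simp
  ultimately show ?thesis
    unfolding entered_def using emeasure_subadditive[of "ambit_set \<phi>" lborel "{0..<t} \<times> {0<..<\<phi> 0}"]
      ambit_at_borel[of 0] ambit_finite unfolding ambit_at_0
    by (auto intro: le_less_trans)
qed

lemma departed_finite: "emeasure lborel (departed t) < \<infinity>"
proof -
  have "emeasure lborel (departed t) \<le> emeasure lborel (entered t)"
    using entered_borel by (intro emeasure_mono) (auto simp: departed_def)
  then show ?thesis using entered_finite by (rule le_less_trans)
qed

end

section \<open>Almost sure convergence along the truncation levels\<close>

locale ambit_jumps = poisson_jumps M N l + ambit \<phi>
  for M :: "'w measure" and N l \<phi> +
  fixes \<epsilon> :: "nat \<Rightarrow> real"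
  assumes eps: "decseq \<epsilon>" "\<epsilon> \<longlonglongrightarrow> 0" "\<And>n. 0 < \<epsilon> n \<and> \<epsilon> n < 1"
begin

text \<open>Two decompositions are multiplied out: the small jumps beyond \<open>u\<close> are those
  beyond \<open>v\<close> plus a shell, and on the shell the indicator of the ambit set is that of
  \<open>entered t\<close> minus that of \<open>departed t\<close>. Any measure finite on the strip
  is allowed, so that realisation and intensity are treated alike.\<close>

lemma integral_small_jumps_split:
  assumes t: "0 \<le> t" and u: "0 < u" "u \<le> v" "v < 1"
    and \<mu>: "sets \<mu> = sets borel" and fin: "emeasure \<mu> (entered t \<times> small_jumps u) < \<infinity>"
  shows "(\<integral>p. jumps (ambit_at t) (small_jumps u) p \<partial>\<mu>) = (\<integral>p. jumps (ambit_at t) (small_jumps v) p \<partial>\<mu>)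
    + (\<integral>p. jumps (entered t) (shell u v) p \<partial>\<mu>) - (\<integral>p. jumps (departed t) (shell u v) p \<partial>\<mu>)"
proof -
  have E: "entered t \<times> small_jumps u \<in> sets borel" by (simp add: Times_borel entered_borel)
  have integ: "integrable \<mu> (jumps B E)"
    if "B \<in> sets borel" "E \<in> sets borel" "B \<subseteq> entered t" "E \<subseteq> small_jumps u" for B E
  proof (rule bounded_integrable_on[where c=1])
    show "B \<times> E \<in> sets \<mu>" using that \<mu> by (simp add: Times_borel)
    have "emeasure \<mu> (B \<times> E) \<le> emeasure \<mu> (entered t \<times> small_jumps u)"
      using that E \<mu> by (intro emeasure_mono) auto
    then show "emeasure \<mu> (B \<times> E) < \<infinity>" using fin by (rule le_less_trans)
    show "\<bar>snd p\<bar> \<le> 1" if "p \<in> B \<times> E" for p using that \<open>E \<subseteq> small_jumps u\<close> by (auto simp: small_jumps_def)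
  qed (use \<mu> in \<open>simp cong: measurable_cong_sets\<close>)
  have sub: "small_jumps v \<subseteq> small_jumps u" "shell u v \<subseteq> small_jumps u"
    using u by (auto simp: small_jumps_def shell_def)
  note A = ambit_at_borel ambit_at_subset_entered[OF t]
  have D: "departed t \<subseteq> entered t" by (auto simp: departed_def)
  have pt: "jumps (ambit_at t) (small_jumps u) p = jumps (ambit_at t) (small_jumps v) p
      + jumps (entered t) (shell u v) p - jumps (departed t) (shell u v) p" for p
  proof -
    have eq: "indicator (ambit_at t) z = (indicator (entered t) z - indicator (departed t) z :: real)" for z
      using A(2) by (auto simp: departed_def indicator_def)
    show ?thesis
      by (cases p) (simp add: indicator_times small_jumps_split[OF u] eq, simp add: algebra_simps)
  qed
  show ?thesis
    unfolding pt using A D sub entered_borel departed_borel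
    by (simp add: integ)
qed

lemma Lj_eps_diff:
  assumes t: "0 \<le> t" and n: "n0 \<le> n"
    and \<omega>: "\<omega> \<in> space M" "emeasure (N \<omega>) (entered t \<times> small_jumps (\<epsilon> n)) < \<infinity>"
  shows "Lj_eps N l (\<epsilon> n) (ambit_at t) \<omega> - Lj_eps N l (\<epsilon> n0) (ambit_at t) \<omega>
    = compensated (jumps (entered t) (shell (\<epsilon> n) (\<epsilon> n0))) \<omega>
      - compensated (jumps (departed t) (shell (\<epsilon> n) (\<epsilon> n0))) \<omega>"
proof -
  have e: "0 < \<epsilon> n" "\<epsilon> n \<le> \<epsilon> n0" "\<epsilon> n0 < 1" using eps n by (auto simp: decseq_def)
  have fin: "emeasure (intensity l) (entered t \<times> small_jumps (\<epsilon> n)) < \<infinity>"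
    by (rule emeasure_strip_finite[OF entered_borel entered_finite e(1)]) (auto simp: small_jumps_def)
  show ?thesis
    unfolding Lj_eps_def compensated_def
      integral_small_jumps_split[OF t e sets_N[OF \<omega>(1)] \<omega>(2)]
      integral_small_jumps_split[OF t e sets_intensity fin]
    by simp
qed

lemma Lj_eps_measurable:
  assumes "B \<in> sets borel" shows "Lj_eps N l u B \<in> borel_measurable M"
proof -
  have b: "big_jumps \<in> sets borel" unfolding big_jumps_def by measurable
  have m: "(\<lambda>\<omega>. \<integral>p. jumps B (small_jumps u) p \<partial>N \<omega>) \<in> borel_measurable M"
    "(\<lambda>\<omega>. \<integral>p. jumps B big_jumps p \<partial>N \<omega>) \<in> borel_measurable M"
    using assms b by (auto intro!: measurable_integral_N jumps_borel)
  show ?thesis unfolding Lj_eps_def[abs_def] by (intro borel_measurable_add borel_measurable_diff borel_measurable_const m)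
qed

text \<open>Convergence in probability makes it impossible, up to a null set, that all later
  truncations stay away from \<open>Z\<close> by more than a fixed distance. Infinitely many close
  truncations are enough to identify the limit once the sequence is known to be Cauchy.\<close>

lemma Lj_eps_accumulates:
  assumes Z: "is_Lj M N l B Z" and B: "B \<in> sets borel"
  shows "AE \<omega> in M. \<forall>j n0. \<exists>n\<ge>n0. \<bar>Lj_eps N l (\<epsilon> n) B \<omega> - Z \<omega>\<bar> \<le> 1 / real (Suc j)"
proof -
  have [measurable]: "Z \<in> borel_measurable M" using Z by (simp add: is_Lj_def)
  have "AE \<omega> in M. \<exists>n\<ge>n0. \<bar>Lj_eps N l (\<epsilon> n) B \<omega> - Z \<omega>\<bar> \<le> \<delta>" if \<delta>: "0 < \<delta>" for n0 \<delta>
  proof -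
    define S where "S = {\<omega> \<in> space M. \<forall>n\<ge>n0. \<not> \<bar>Lj_eps N l (\<epsilon> n) B \<omega> - Z \<omega>\<bar> \<le> \<delta>}"
    have [measurable]: "Lj_eps N l (\<epsilon> n) B \<in> borel_measurable M" for n by (rule Lj_eps_measurable[OF B])
    have S: "S \<in> events" unfolding S_def by measurable
    have "prob S \<le> \<eta>" if \<eta>: "0 < \<eta>" for \<eta>
    proof -
      have lim: "filterlim \<epsilon> (at_right 0) sequentially"
        using eps by (intro tendsto_imp_filterlim_at_right) auto
      have "\<forall>\<^sub>F u in at_right 0. \<exists>E\<in>sets M. measure M E < \<eta> \<and>
          (AE \<omega> in M. \<omega> \<notin> E \<longrightarrow> \<bar>Lj_eps N l u B \<omega> - Z \<omega>\<bar> \<le> \<delta>)"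
        using Z \<delta> \<eta> unfolding is_Lj_def by blast
      from eventually_compose_filterlim[OF this lim]
      have "\<forall>\<^sub>F n in sequentially. n0 \<le> n \<and> (\<exists>E\<in>sets M. measure M E < \<eta> \<and>
          (AE \<omega> in M. \<omega> \<notin> E \<longrightarrow> \<bar>Lj_eps N l (\<epsilon> n) B \<omega> - Z \<omega>\<bar> \<le> \<delta>))"
        using eventually_ge_at_top[of n0] by eventually_elim simp
      then obtain n E where n: "n0 \<le> n" "E \<in> sets M" "measure M E < \<eta>"
          "AE \<omega> in M. \<omega> \<notin> E \<longrightarrow> \<bar>Lj_eps N l (\<epsilon> n) B \<omega> - Z \<omega>\<bar> \<le> \<delta>"
        using eventually_happens'[OF sequentially_bot] by blast
      have "AE \<omega> in M. \<omega> \<in> S \<longrightarrow> \<omega> \<in> E"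
        using n(4) by eventually_elim (use n(1) in \<open>auto simp: S_def\<close>)
      then have "prob S \<le> prob E" using n(2) by (rule finite_measure_mono_AE)
      then show ?thesis using n(3) by simp
    qed
    then have "prob S \<le> 0" by (rule field_le_epsilon) simp
    then have "prob S = 0" using measure_nonneg[of M S] by linarith
    then have "AE \<omega> in M. \<omega> \<notin> S" using S by (intro AE_not_in) (simp add: null_sets_def emeasure_eq_measure)
    then show ?thesis using AE_space by eventually_elim (auto simp: S_def)
  qed
  then show ?thesis by (simp add: AE_all_countable)
qed

lemma Lj_eps_uniformly_Cauchy:
  "AE \<omega> in M. \<forall>T j. \<exists>n0. \<forall>n\<ge>n0. \<forall>k i. i \<le> T * 2 ^ k \<longrightarrow>
     \<bar>Lj_eps N l (\<epsilon> n) (ambit_at (dyadic k i)) \<omega> - Lj_eps N l (\<epsilon> n0) (ambit_at (dyadic k i)) \<omega>\<bar> \<le> 1 / real (Suc j)"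
proof -
  have d0: "0 \<le> dyadic k i" for k i by (simp add: dyadic_def)
  have fin: "AE \<omega> in M. \<forall>k i n. emeasure (N \<omega>) (entered (dyadic k i) \<times> small_jumps (\<epsilon> n)) < \<infinity>"
    unfolding AE_all_countable
  proof (intro allI N_finite)
    fix k i n
    show "entered (dyadic k i) \<times> small_jumps (\<epsilon> n) \<in> sets borel" by (simp add: Times_borel entered_borel)
    show "emeasure (intensity l) (entered (dyadic k i) \<times> small_jumps (\<epsilon> n)) < \<infinity>"
      by (rule emeasure_strip_finite[OF entered_borel entered_finite, where u="\<epsilon> n"]) (use eps in \<open>auto simp: small_jumps_def\<close>)
  qed
  \<comment> \<open>Entered and departed points each contribute up to \<open>4 L\<close>, so the
    tolerance \<open>1/(j + 1)\<close> is divided by 8.\<close>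
  define L where "L j = 1 / real (Suc j) / 8" for j
  have L: "0 < L j" for j by (simp add: L_def)
  have L8: "4 * L j + 4 * L j = 1 / real (Suc j)" for j unfolding L_def by linarith
  define Bad where "Bad T j n = large_deviation entered \<epsilon> (L j) T n \<union> large_deviation departed \<epsilon> (L j) T n" for T j n
  have m: "large_deviation entered \<epsilon> (L j) T n \<in> events" "large_deviation departed \<epsilon> (L j) T n \<in> events" for T j n
    by (auto intro: large_deviation_measurable entered_borel departed_borel)
  have "AE \<omega> in M. \<exists>n. \<omega> \<notin> Bad T j n" for T j
  proof (rule AE_ex_notin_of_prob_tendsto_0)
    show "Bad T j n \<in> events" for n unfolding Bad_def using m by auto
    show "(\<lambda>n. prob (Bad T j n)) \<longlonglongrightarrow> 0"
    proof (rule tendsto_sandwich[where f="\<lambda>_. 0" and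
          h="\<lambda>n. prob (large_deviation entered \<epsilon> (L j) T n) + prob (large_deviation departed \<epsilon> (L j) T n)"])
      show "(\<lambda>n. prob (large_deviation entered \<epsilon> (L j) T n) + prob (large_deviation departed \<epsilon> (L j) T n)) \<longlonglongrightarrow> 0"
        by (intro tendsto_add_zero large_deviation_tendsto_0 mono_entered entered_borel entered_finite
            mono_departed departed_borel departed_finite eps L)
      show "\<forall>\<^sub>F n in sequentially. prob (Bad T j n)
          \<le> prob (large_deviation entered \<epsilon> (L j) T n) + prob (large_deviation departed \<epsilon> (L j) T n)"
        unfolding Bad_def using m by (intro always_eventually allI measure_Un_le)
    qed auto
  qed
  then have "AE \<omega> in M. \<forall>T j. \<exists>n. \<omega> \<notin> Bad T j n" by (simp add: AE_all_countable)
  then show ?thesis using fin AE_space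
  proof eventually_elim
    case (elim \<omega>)
    show ?case
    proof (intro allI)
      fix T j
      obtain n0 where n0: "\<omega> \<notin> Bad T j n0" using elim(1) by blast
      have "\<bar>Lj_eps N l (\<epsilon> n) (ambit_at (dyadic k i)) \<omega> - Lj_eps N l (\<epsilon> n0) (ambit_at (dyadic k i)) \<omega>\<bar> \<le> 1 / real (Suc j)"
        if n: "n0 \<le> n" and i: "i \<le> T * 2 ^ k" for n k i
      proof -
        have "\<bar>compensated (jumps (entered (dyadic k i)) (shell (\<epsilon> n) (\<epsilon> n0))) \<omega>\<bar> \<le> 4 * L j"
          "\<bar>compensated (jumps (departed (dyadic k i)) (shell (\<epsilon> n) (\<epsilon> n0))) \<omega>\<bar> \<le> 4 * L j"
          using n0 n i elim(3) unfolding Bad_def large_deviation_def by (simp_all add: not_less)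
        then show ?thesis
          using Lj_eps_diff[OF d0 n elim(3), of k i] elim(2) L8[of j] by (simp del: of_nat_Suc)
      qed
      then show "\<exists>n0. \<forall>n\<ge>n0. \<forall>k i. i \<le> T * 2 ^ k \<longrightarrow>
         \<bar>Lj_eps N l (\<epsilon> n) (ambit_at (dyadic k i)) \<omega> - Lj_eps N l (\<epsilon> n0) (ambit_at (dyadic k i)) \<omega>\<bar> \<le> 1 / real (Suc j)"
        by blast
    qed
  qed
qed

text \<open>The summand \<open>g\<close> treats both claims at once: it is 0 for pure jumps and the
  Gaussian term otherwise.\<close>

lemma cadlag_versions_converge:
  fixes X :: "real \<Rightarrow> 'w \<Rightarrow> real" and Y :: "nat \<Rightarrow> real \<Rightarrow> 'w \<Rightarrow> real" and g :: "real \<Rightarrow> 'w \<Rightarrow> real"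
  assumes X: "\<forall>\<omega>\<in>space M. cadlag (\<lambda>t. X t \<omega>)"
    and XZ: "\<forall>t\<ge>0. \<exists>Z. is_Lj M N l (ambit_at t) Z \<and> (AE \<omega> in M. X t \<omega> = Z \<omega> + g t \<omega>)"
    and Y: "\<forall>n. \<forall>\<omega>\<in>space M. cadlag (\<lambda>t. Y n t \<omega>)"
    and YL: "\<forall>n. \<forall>t\<ge>0. AE \<omega> in M. Y n t \<omega> = Lj_eps N l (\<epsilon> n) (ambit_at t) \<omega> + g t \<omega>"
  shows "AE \<omega> in M. \<forall>T>0. uniform_limit {0..T} (\<lambda>n t. Y n t \<omega>) (\<lambda>t. X t \<omega>) sequentially"
proof -
  have d0: "0 \<le> dyadic k i" for k i by (simp add: dyadic_def)
  have Yd: "AE \<omega> in M. \<forall>n k i. Y n (dyadic k i) \<omega> = Lj_eps N l (\<epsilon> n) (ambit_at (dyadic k i)) \<omega> + g (dyadic k i) \<omega>"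
    unfolding AE_all_countable using YL d0 by blast
  have "AE \<omega> in M. \<forall>j n0. \<exists>n\<ge>n0. \<bar>Lj_eps N l (\<epsilon> n) (ambit_at (dyadic k i)) \<omega> + g (dyadic k i) \<omega> - X (dyadic k i) \<omega>\<bar> \<le> 1 / real (Suc j)" for k i
  proof -
    obtain Z where Z: "is_Lj M N l (ambit_at (dyadic k i)) Z" "AE \<omega> in M. X (dyadic k i) \<omega> = Z \<omega> + g (dyadic k i) \<omega>"
      using XZ d0 by blast
    show ?thesis
      using Lj_eps_accumulates[OF Z(1) ambit_at_borel] Z(2) by eventually_elim simp
  qed
  then have Xd: "AE \<omega> in M. \<forall>k i j n0. \<exists>n\<ge>n0. \<bar>Lj_eps N l (\<epsilon> n) (ambit_at (dyadic k i)) \<omega> + g (dyadic k i) \<omega> - X (dyadic k i) \<omega>\<bar> \<le> 1 / real (Suc j)"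
    unfolding AE_all_countable by blast
  show ?thesis using Yd Xd Lj_eps_uniformly_Cauchy AE_space
  proof eventually_elim
    case (elim \<omega>)
    show ?case
    proof (intro allI impI uniform_limitI)
      fix T \<delta> :: real assume T: "0 < T" and \<delta>: "0 < \<delta>"
      \<comment> \<open>Three errors of this size are added: from level \<open>n\<close> to
        \<open>n0\<close>, from \<open>n0\<close> to some later \<open>m\<close>, and from
        \<open>m\<close> to \<open>X\<close>. A quarter each keeps the total strictly below
        \<open>\<delta>\<close>.\<close>
      obtain j where j: "1 / real (Suc j) < \<delta> / 4"
        using reals_Archimedean[of "\<delta> / 4"] \<delta> by (auto simp: inverse_eq_divide)
      obtain n0 where n0: "\<And>n k i. n0 \<le> n \<Longrightarrow> i \<le> nat \<lceil>T + 1\<rceil> * 2 ^ k \<Longrightarrow>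
          \<bar>Lj_eps N l (\<epsilon> n) (ambit_at (dyadic k i)) \<omega> - Lj_eps N l (\<epsilon> n0) (ambit_at (dyadic k i)) \<omega>\<bar> \<le> 1 / real (Suc j)"
        using elim(3) by meson
      have dyad: "\<bar>Y n (dyadic k i) \<omega> - X (dyadic k i) \<omega>\<bar> \<le> 3 * (\<delta> / 4)"
        if n: "n0 \<le> n" and i: "i \<le> nat \<lceil>T + 1\<rceil> * 2 ^ k" for n k i
      proof -
        \<comment> \<open>The level \<open>m\<close> may vary with the dyadic time, but it only
          serves as an intermediate point; \<open>n0\<close> is common to all times, which makes the
          estimate uniform.\<close>
        obtain m where m: "n0 \<le> m"
          "\<bar>Lj_eps N l (\<epsilon> m) (ambit_at (dyadic k i)) \<omega> + g (dyadic k i) \<omega> - X (dyadic k i) \<omega>\<bar> \<le> 1 / real (Suc j)"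
          using elim(2) by blast
        have "Y n (dyadic k i) \<omega> = Lj_eps N l (\<epsilon> n) (ambit_at (dyadic k i)) \<omega> + g (dyadic k i) \<omega>"
          using elim(1) by blast
        then show ?thesis using n0[OF n i] n0[OF m(1) i] m(2) j by linarith
      qed
      have "\<bar>Y n t \<omega> - X t \<omega>\<bar> \<le> 3 * (\<delta> / 4)" if n: "n0 \<le> n" and t: "t \<in> {0..T}" for n t
      \<comment> \<open>The horizon \<open>T + 1\<close> leaves room for dyadic times to the right
        of \<open>t\<close> even when \<open>t = T\<close>.\<close>
      proof (rule abs_le_of_dyadic[where f="\<lambda>t. Y n t \<omega> - X t \<omega>" and t=t and T="T + 1"])
        have "((\<lambda>t. Y n t \<omega>) \<longlongrightarrow> Y n t \<omega>) (at_right t)" "((\<lambda>t. X t \<omega>) \<longlongrightarrow> X t \<omega>) (at_right t)"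
          using X Y elim(4) t unfolding cadlag_def by auto
        then show "((\<lambda>t. Y n t \<omega> - X t \<omega>) \<longlongrightarrow> Y n t \<omega> - X t \<omega>) (at_right t)" by (rule tendsto_diff)
      qed (use t dyad[OF n] in auto)
      moreover have "3 * (\<delta> / 4) < \<delta>" using \<delta> by simp
      ultimately show "\<forall>\<^sub>F n in sequentially. \<forall>t\<in>{0..T}. dist (Y n t \<omega>) (X t \<omega>) < \<delta>"
        unfolding eventually_sequentially dist_real_def by (intro exI[of _ n0]) (meson le_less_trans)
    qed
  qed
qed

end

theorem theorem3p4:
  fixes M :: "'w measure" and N :: "'w \<Rightarrow> ((real \<times> real) \<times> real) measure"
    and l :: "real measure" and \<phi> :: "real \<Rightarrow> real" and \<epsilon> :: "nat \<Rightarrow> real"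
  assumes "prob_space M" and "levy_measure l" and "poisson_random_measure M N l"
    and "continuous_on {..0} \<phi>" and "mono_on {..0} \<phi>" and "\<forall>s\<le>0. 0 \<le> \<phi> s"
    and "set_integrable lborel {..0} \<phi>"
    and "decseq \<epsilon>" and "\<epsilon> \<longlonglongrightarrow> 0" and "\<forall>n. 0 < \<epsilon> n \<and> \<epsilon> n < 1"
  shows
    "(\<forall>(X :: real \<Rightarrow> 'w \<Rightarrow> real) (Y :: nat \<Rightarrow> real \<Rightarrow> 'w \<Rightarrow> real).
        (\<forall>\<omega>\<in>space M. cadlag (\<lambda>t. X t \<omega>)) \<and>
        (\<forall>t\<ge>0. \<exists>Z. is_Lj M N l (shift_set (ambit_set \<phi>) t) Z \<and> (AE \<omega> in M. X t \<omega> = Z \<omega>)) \<and>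
        (\<forall>n. \<forall>\<omega>\<in>space M. cadlag (\<lambda>t. Y n t \<omega>)) \<and>
        (\<forall>n. \<forall>t\<ge>0. AE \<omega> in M. Y n t \<omega> = Lj_eps N l (\<epsilon> n) (shift_set (ambit_set \<phi>) t) \<omega>)
        \<longrightarrow> (AE \<omega> in M. \<forall>T>0. uniform_limit {0..T} (\<lambda>n t. Y n t \<omega>) (\<lambda>t. X t \<omega>) sequentially))
     \<and>
     (\<forall>(\<xi> :: real) (a :: real) (G :: (real \<times> real) set \<Rightarrow> 'w \<Rightarrow> real)
        (X :: real \<Rightarrow> 'w \<Rightarrow> real) (Y :: nat \<Rightarrow> real \<Rightarrow> 'w \<Rightarrow> real).
        gaussian_levy_basis M \<xi> a G \<and> indep_gauss_prm M N l G \<and>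
        (\<forall>\<omega>\<in>space M. cadlag (\<lambda>t. X t \<omega>)) \<and>
        (\<forall>t\<ge>0. \<exists>Z. is_Lj M N l (shift_set (ambit_set \<phi>) t) Z \<and>
            (AE \<omega> in M. X t \<omega> = Z \<omega> + G (shift_set (ambit_set \<phi>) t) \<omega>)) \<and>
        (\<forall>n. \<forall>\<omega>\<in>space M. cadlag (\<lambda>t. Y n t \<omega>)) \<and>
        (\<forall>n. \<forall>t\<ge>0. AE \<omega> in M. Y n t \<omega> =
            Lj_eps N l (\<epsilon> n) (shift_set (ambit_set \<phi>) t) \<omega> + G (shift_set (ambit_set \<phi>) t) \<omega>)
        \<longrightarrow> (AE \<omega> in M. \<forall>T>0. uniform_limit {0..T} (\<lambda>n t. Y n t \<omega>) (\<lambda>t. X t \<omega>) sequentially))"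
proof -
  interpret prob_space M by fact
  interpret ambit_jumps M N l \<phi> \<epsilon>
    using assms by unfold_locales auto
  show ?thesis
  proof (intro conjI allI impI, goal_cases)
    case (1 X Y)
    then show ?case by (intro cadlag_versions_converge[where g="\<lambda>_ _. 0"]) auto
  next
    case (2 \<xi> a G X Y)
    then show ?case by (intro cadlag_versions_converge[where g="\<lambda>t. G (ambit_at t)"]) auto
  qed
qed

end
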